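(* Let $X$ be a complex Banach space, regarded as a subspace of its double dual $X^{**}$ via the canonical embedding. Then for all $x,y\in B_X$, $$K_{X^{**}}(x,y)=K_X(x,y),$$ where $K_X$ and $K_{X^{**}}$ denote the Kobayashi distances on the open unit balls $B_X$ and $B_{X^{**}}$ respectively.
   Context: $\mathbb{D}$ is the open unit disc in $\mathbb{C}$ and $\rho(z,w)=\tanh^{-1}\left|\frac{z-w}{1-\bar w z}\right|$ is the Poincaré distance on $\mathbb{D}$. $H(\mathcal{D}_1,\mathcal{D}_2)$ is the set of holomorphic maps from $\mathcal{D}_1$ to $\mathcal{D}_2$. For a domain $\mathcal{D}$ in a complex Banach space and $p,q\in\mathcal{D}$, $$\delta_{\mathcal{D}}(p,q)=\inf\{\rho(u,v):\exists f\in H(\mathbb{D},\mathcal{D}),\ f(u)=p,\ f(v)=q\},$$ and the Kobayashi distance is $$K_{\mathcal{D}}(p,q)=\inf\Big\{\sum_{i=1}^n\delta_{\mathcal{D}}(w_{i-1},w_i): n\ge 1,\ p=w_0,w_1,\dots,w_n=q\in\mathcal{D}\Big\}.$$ $K_X$ abbreviates $K_{B_X}$, where $B_X$ is the open unit ball of $X$. *)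

theory Defs
  imports "HOL-Analysis.Analysis"
begin

section \<open>Complex normed and Banach spaces\<close>

class complex_normed_vector = real_normed_vector +
  fixes scaleC :: "complex \<Rightarrow> 'a \<Rightarrow> 'a"  (infixr "*\<^sub>C" 75)
  assumes scaleC_add_right: "a *\<^sub>C (x + y) = a *\<^sub>C x + a *\<^sub>C y"
    and scaleC_add_left: "(a + b) *\<^sub>C x = a *\<^sub>C x + b *\<^sub>C x"
    and scaleC_scaleC: "a *\<^sub>C (b *\<^sub>C x) = (a * b) *\<^sub>C x"
    and scaleC_of_real: "complex_of_real r *\<^sub>C x = r *\<^sub>R x"
    and norm_scaleC: "norm (a *\<^sub>C x) = norm a * norm x"

class complex_banach = complex_normed_vector + complete_space

subclass (in complex_banach) banach ..

instantiation complex :: complex_banach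
begin

definition scaleC_complex :: "complex \<Rightarrow> complex \<Rightarrow> complex"
  where "scaleC_complex a x = a * x"

instance
  by standard (auto simp: scaleC_complex_def algebra_simps norm_mult scaleR_conv_of_real)

end


section \<open>The dual space\<close>

typedef (overloaded) 'a cdual =
  "{f :: 'a::complex_normed_vector \<Rightarrow>\<^sub>L complex. \<forall>c x. blinfun_apply f (c *\<^sub>C x) = c * blinfun_apply f x}"
  by (rule exI[of _ 0]) simp

setup_lifting type_definition_cdual

lift_definition cdual_apply :: "'a::complex_normed_vector cdual \<Rightarrow> 'a \<Rightarrow> complex"
  is blinfun_apply .

text \<open>The norm of a functional is its operator norm, inherited from the real-linear
  bounded maps.\<close>

instantiation cdual :: (complex_normed_vector) complex_normed_vector
begin

lift_definition zero_cdual :: "'a cdual" is 0 by simp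
lift_definition plus_cdual :: "'a cdual \<Rightarrow> 'a cdual \<Rightarrow> 'a cdual" is "(+)"
  by (simp add: blinfun.bilinear_simps algebra_simps)
lift_definition minus_cdual :: "'a cdual \<Rightarrow> 'a cdual \<Rightarrow> 'a cdual" is "(-)"
  by (simp add: blinfun.bilinear_simps algebra_simps)
lift_definition uminus_cdual :: "'a cdual \<Rightarrow> 'a cdual" is uminus
  by (simp add: blinfun.bilinear_simps)
lift_definition scaleR_cdual :: "real \<Rightarrow> 'a cdual \<Rightarrow> 'a cdual" is scaleR
  by (simp add: blinfun.bilinear_simps scaleR_conv_of_real)
lift_definition scaleC_cdual :: "complex \<Rightarrow> 'a cdual \<Rightarrow> 'a cdual"
  is "\<lambda>c f. blinfun_mult_right c o\<^sub>L f"
  by simp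
lift_definition norm_cdual :: "'a cdual \<Rightarrow> real" is norm .

definition dist_cdual :: "'a cdual \<Rightarrow> 'a cdual \<Rightarrow> real"
  where "dist_cdual f g = norm (f - g)"
definition sgn_cdual :: "'a cdual \<Rightarrow> 'a cdual"
  where "sgn_cdual f = inverse (norm f) *\<^sub>R f"
definition uniformity_cdual :: "('a cdual \<times> 'a cdual) filter"
  where "uniformity_cdual = (INF e\<in>{0<..}. principal {(x, y). dist x y < e})"
definition open_cdual :: "'a cdual set \<Rightarrow> bool"
  where "open_cdual S = (\<forall>x\<in>S. \<forall>\<^sub>F (x', y) in uniformity. x' = x \<longrightarrow> y \<in> S)"

instance
proof
  fix a b :: complex and r s :: real and f g h :: "'a cdual" and S :: "'a cdual set"
  show "f + g + h = f + (g + h)" "f + g = g + f" "0 + f = f" "- f + f = 0" "f - g = f + - g"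
    by (transfer, simp)+
  show "r *\<^sub>R (f + g) = r *\<^sub>R f + r *\<^sub>R g" "(r + s) *\<^sub>R f = r *\<^sub>R f + s *\<^sub>R f"
    "r *\<^sub>R s *\<^sub>R f = (r * s) *\<^sub>R f" "1 *\<^sub>R f = f"
    by (transfer, simp add: algebra_simps)+
  show "dist f g = norm (f - g)" by (rule dist_cdual_def)
  show "sgn f = inverse (norm f) *\<^sub>R f" by (rule sgn_cdual_def)
  show "(uniformity :: ('a cdual \<times> 'a cdual) filter) = (INF e\<in>{0<..}. principal {(x, y). dist x y < e})"
    by (rule uniformity_cdual_def)
  show "open S = (\<forall>x\<in>S. \<forall>\<^sub>F (x', y) in uniformity. x' = x \<longrightarrow> y \<in> S)"
    by (rule open_cdual_def)
  show "(norm f = 0) = (f = 0)" by transfer simp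
  show "norm (f + g) \<le> norm f + norm g" by transfer (rule norm_triangle_ineq)
  show "norm (r *\<^sub>R f) = \<bar>r\<bar> * norm f" by transfer simp
  show "a *\<^sub>C (f + g) = a *\<^sub>C f + a *\<^sub>C g" "(a + b) *\<^sub>C f = a *\<^sub>C f + b *\<^sub>C f"
    "a *\<^sub>C b *\<^sub>C f = (a * b) *\<^sub>C f" "complex_of_real r *\<^sub>C f = r *\<^sub>R f"
    by (transfer, rule blinfun_eqI, simp add: blinfun.bilinear_simps algebra_simps scaleR_conv_of_real)+
  show "norm (a *\<^sub>C f) = norm a * norm f"
  proof transfer
    fix a :: complex and f :: "'a \<Rightarrow>\<^sub>L complex"
    have le: "norm (blinfun_mult_right c o\<^sub>L g) \<le> norm c * norm g" for c and g :: "'a \<Rightarrow>\<^sub>L complex"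
      by (rule norm_blinfun_bound)
        (auto simp: norm_mult mult.assoc intro!: mult_left_mono norm_blinfun)
    show "norm (blinfun_mult_right a o\<^sub>L f) = norm a * norm f"
    proof (cases "a = 0")
      case True
      then show ?thesis using le[of 0 f] by simp
    next
      case False
      have "f = blinfun_mult_right (inverse a) o\<^sub>L (blinfun_mult_right a o\<^sub>L f)"
        by (rule blinfun_eqI) (simp add: False)
      then have "norm f \<le> norm (inverse a) * norm (blinfun_mult_right a o\<^sub>L f)"
        using le[of "inverse a" "blinfun_mult_right a o\<^sub>L f"] by simp
      then have "norm f \<le> norm (blinfun_mult_right a o\<^sub>L f) / norm a"
        by (simp add: norm_inverse inverse_eq_divide norm_divide)
      then have "norm a * norm f \<le> norm (blinfun_mult_right a o\<^sub>L f)"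
        using False by (simp add: pos_le_divide_eq mult.commute)
      then show ?thesis using le[of a f] by simp
    qed
  qed
qed

end

lemma norm_cdual_eq_onorm: "norm f = onorm (cdual_apply f)"
  by transfer (rule norm_blinfun.rep_eq)

lemma cdual_eqI: "(\<And>x. cdual_apply f x = cdual_apply g x) \<Longrightarrow> f = g"
  by transfer (rule blinfun_eqI)

lemma cdual_apply_linear:
  "cdual_apply f (x + y) = cdual_apply f x + cdual_apply f y"
  "cdual_apply f (c *\<^sub>C x) = c * cdual_apply f x"
  "cdual_apply (f + g) x = cdual_apply f x + cdual_apply g x"
  "cdual_apply (c *\<^sub>C f) x = c * cdual_apply f x"
  "cdual_apply (r *\<^sub>R f) x = r *\<^sub>R cdual_apply f x"
  by (transfer, simp add: blinfun.bilinear_simps)+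

lemma norm_cdual_apply: "norm (cdual_apply f x) \<le> norm f * norm x"
  by transfer (rule norm_blinfun)

instance cdual :: (complex_normed_vector) complex_banach
proof
  fix X :: "nat \<Rightarrow> 'a cdual"
  assume X: "Cauchy X"
  have dist_Rep: "dist (Rep_cdual f) (Rep_cdual g) = dist f g" for f g :: "'a cdual"
    by (simp add: dist_norm norm_cdual.rep_eq minus_cdual.rep_eq)
  have "Cauchy (\<lambda>n. Rep_cdual (X n))"
    using X by (simp add: Cauchy_def dist_Rep)
  then obtain L where L: "(\<lambda>n. Rep_cdual (X n)) \<longlonglongrightarrow> L"
    using Cauchy_convergent convergent_def by blast
  have lim: "(\<lambda>n. blinfun_apply (Rep_cdual (X n)) x) \<longlonglongrightarrow> blinfun_apply L x" for x
    by (intro tendsto_intros L)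
  have "blinfun_apply L (c *\<^sub>C x) = c * blinfun_apply L x" for c x
  proof (rule LIMSEQ_unique[OF lim])
    have "blinfun_apply (Rep_cdual (X n)) (c *\<^sub>C x) = c * blinfun_apply (Rep_cdual (X n)) x" for n
      using Rep_cdual[of "X n"] by blast
    then show "(\<lambda>n. blinfun_apply (Rep_cdual (X n)) (c *\<^sub>C x)) \<longlonglongrightarrow> c * blinfun_apply L x"
      by (simp only:) (intro tendsto_mult tendsto_const lim)
  qed
  then have "Rep_cdual (Abs_cdual L) = L"
    by (simp add: Abs_cdual_inverse)
  then have "X \<longlonglongrightarrow> Abs_cdual L"
    using L by (simp add: tendsto_iff flip: dist_Rep)
  then show "convergent X" by (rule convergentI)
qed

lemma bounded_linear_cdual_eval: "bounded_linear (\<lambda>\<phi>. cdual_apply \<phi> x)"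
  by (rule bounded_linear_intro[where K = "norm x"])
    (simp_all add: cdual_apply_linear norm_cdual_apply)

text \<open>The canonical embedding of a space into its double dual, evaluation at a point.\<close>

lift_definition canonical_embedding :: "'a::complex_normed_vector \<Rightarrow> 'a cdual cdual"
  is "\<lambda>x. Blinfun (\<lambda>\<phi>. cdual_apply \<phi> x)"
  by (simp add: bounded_linear_Blinfun_apply bounded_linear_cdual_eval cdual_apply_linear)

lemma canonical_embedding_apply: "cdual_apply (canonical_embedding x) \<phi> = cdual_apply \<phi> x"
  by (simp add: cdual_apply.rep_eq[of "canonical_embedding x"] canonical_embedding.rep_eq
      bounded_linear_Blinfun_apply bounded_linear_cdual_eval)


section \<open>Holomorphic maps and the Kobayashi distance\<close>

text \<open>Holomorphic maps between domains of complex normed spaces are the maps that are Frechet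
  differentiable with complex-linear derivative. Maps are total functions here; their values
  outside the (open) set \<open>D1\<close> are irrelevant.\<close>

definition holomorphic_maps ::
    "'a::complex_normed_vector set \<Rightarrow> 'b::complex_normed_vector set \<Rightarrow> ('a \<Rightarrow> 'b) set"
  where "holomorphic_maps D1 D2 =
    {f. f ` D1 \<subseteq> D2 \<and>
        (\<forall>z\<in>D1. \<exists>L. (f has_derivative L) (at z) \<and> (\<forall>c h. L (c *\<^sub>C h) = c *\<^sub>C L h))}"

definition poincare_dist :: "complex \<Rightarrow> complex \<Rightarrow> real"
  where "poincare_dist z w = artanh (norm ((z - w) / (1 - cnj w * z)))"

text \<open>The infima are taken in the extended reals, so that the infimum of the empty set is
  \<open>\<infinity>\<close>.\<close>

definition lempert_fun :: "'a::complex_normed_vector set \<Rightarrow> 'a \<Rightarrow> 'a \<Rightarrow> ereal"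
  where "lempert_fun D p q =
    Inf {ereal (poincare_dist u v) | u v. u \<in> ball 0 1 \<and> v \<in> ball 0 1 \<and>
           (\<exists>f \<in> holomorphic_maps (ball 0 1) D. f u = p \<and> f v = q)}"

definition kobayashi_dist :: "'a::complex_normed_vector set \<Rightarrow> 'a \<Rightarrow> 'a \<Rightarrow> ereal"
  where "kobayashi_dist D p q =
    Inf {(\<Sum>i = 1..n. lempert_fun D (w (i - 1)) (w i)) | (n::nat) w.
           n \<ge> 1 \<and> w 0 = p \<and> w n = q \<and> (\<forall>i\<le>n. w i \<in> D)}"

end

theory Submission
  imports
    Defs
    "HOL-Complex_Analysis.Complex_Analysis"
    "HOL-Library.Function_Algebras"
begin

text \<open>
  Composing with the canonical embedding, a linear contraction, gives the inequality
  \<open>\<le>\<close>. For \<open>\<ge>\<close>, take a chain of analytic discs in the ball of the bidual joining \<open>x\<close>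
  to \<open>y\<close>. After shrinking the discs slightly, which changes the Poincare distances by as little
  as we like, they can be replaced by polynomial discs of norm \<open>< 1 - \<epsilon>\<close> through the same
  points. The chain then depends linearly on finitely many vectors of the bidual, namely its
  points and the coefficients of its discs. By an approximate form of the principle of local
  reflexivity, these vectors can be replaced by vectors of the space itself, keeping \<open>x\<close> and \<open>y\<close>
  and increasing the norms of the relevant linear combinations by at most \<open>\<epsilon>\<close>. Local
  reflexivity follows from the Hahn--Banach theorem: if a finite system of inequalities
  \<open>norm (\<xi>\<^sub>k + \<Sum>j. a\<^sub>k\<^sub>j d\<^sub>j) < b\<^sub>k\<close> has no solution \<open>d\<close> in the space, then
  functionals \<open>\<phi>\<^sub>k\<close> with \<open>\<Sum>k. a\<^sub>k\<^sub>j \<phi>\<^sub>k = 0\<close> witness this, and they witness it in the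
  bidual as well.
\<close>

text \<open>Families of vectors, indexed by the inequalities or by the unknowns of a system, become
  real vector spaces, so that Hahn--Banach applies to a whole system at once.\<close>

instantiation "fun" :: (type, real_vector) real_vector
begin

definition scaleR_fun :: "real \<Rightarrow> ('a \<Rightarrow> 'b) \<Rightarrow> 'a \<Rightarrow> 'b"
  where "scaleR_fun r f = (\<lambda>x. r *\<^sub>R f x)"

instance
  by standard (simp_all add: scaleR_fun_def fun_eq_iff algebra_simps)

end

section \<open>A Hahn--Banach theorem for sublinear functionals\<close>

text \<open>Scaling is demanded only as an inequality; applying it to \<open>inverse t\<close> gives
  equality.\<close>

definition sublinear :: "('a::real_vector \<Rightarrow> real) \<Rightarrow> bool"
  where "sublinear p \<longleftrightarrow>
    (\<forall>x y. p (x + y) \<le> p x + p y) \<and> (\<forall>t x. t > 0 \<longrightarrow> p (t *\<^sub>R x) \<le> t * p x)"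

lemma sublinear_add: "sublinear p \<Longrightarrow> p (x + y) \<le> p x + p y"
  by (simp add: sublinear_def)

lemma sublinear_scaleR:
  assumes "sublinear p" "t > 0"
  shows "p (t *\<^sub>R x) = t * p x"
proof (rule antisym)
  show "p (t *\<^sub>R x) \<le> t * p x"
    using assms by (simp add: sublinear_def)
  have "p (inverse t *\<^sub>R (t *\<^sub>R x)) \<le> inverse t * p (t *\<^sub>R x)"
    using assms unfolding sublinear_def by (meson inverse_positive_iff_positive)
  then show "t * p x \<le> p (t *\<^sub>R x)"
    using assms(2) by (simp add: field_simps)
qed

lemma sublinear_zero: "sublinear p \<Longrightarrow> p 0 = 0"
  using sublinear_scaleR[of p 2 0] by simp

lemma sublinear_ge_uminus: "sublinear p \<Longrightarrow> - p (- x) \<le> p x"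
  using sublinear_add[of p x "- x"] sublinear_zero[of p] by simp

text \<open>Of two members \<open>q\<close>, \<open>r\<close> of a chain the smaller,
  \<open>s\<close>, lies below both, so the infimum at \<open>x + y\<close> is at most
  \<open>s x + s y \<le> q x + r y\<close>; the infima over \<open>q\<close> and \<open>r\<close>
  can then be taken separately. This supplies the lower bounds for Zorn's lemma.\<close>

lemma sublinear_directed_INF:
  assumes C: "C \<noteq> {}" "\<And>q. q \<in> C \<Longrightarrow> sublinear q"
    and dir: "\<And>q r. q \<in> C \<Longrightarrow> r \<in> C \<Longrightarrow> q \<le> r \<or> r \<le> q"
    and bdd: "\<And>x. bdd_below ((\<lambda>q. q x) ` C)"
  shows "sublinear (\<lambda>x. INF q\<in>C. q x)"
  unfolding sublinear_def
proof (intro conjI allI impI)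
  fix x y
  have *: "(INF q\<in>C. q (x + y)) \<le> q x + r y" if "q \<in> C" "r \<in> C" for q r
  proof -
    obtain s where s: "s \<in> C" "s \<le> q" "s \<le> r"
      using dir[of q r] \<open>q \<in> C\<close> \<open>r \<in> C\<close> by blast
    have "(INF q\<in>C. q (x + y)) \<le> s (x + y)"
      by (rule cINF_lower[OF bdd s(1)])
    also have "\<dots> \<le> s x + s y"
      by (rule sublinear_add[OF C(2)[OF s(1)]])
    also have "\<dots> \<le> q x + r y"
      using s by (intro add_mono) (auto simp: le_fun_def)
    finally show ?thesis .
  qed
  have "(INF q\<in>C. q (x + y)) - r y \<le> (INF q\<in>C. q x)" if "r \<in> C" for r
    by (rule cINF_greatest[OF C(1)]) (use *[OF _ that] in \<open>simp add: algebra_simps\<close>)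
  then have "(INF q\<in>C. q (x + y)) - (INF q\<in>C. q x) \<le> r y" if "r \<in> C" for r
    using that by (simp add: algebra_simps)
  then have "(INF q\<in>C. q (x + y)) - (INF q\<in>C. q x) \<le> (INF q\<in>C. q y)"
    by (rule cINF_greatest[OF C(1)])
  then show "(INF q\<in>C. q (x + y)) \<le> (INF q\<in>C. q x) + (INF q\<in>C. q y)"
    by simp
next
  fix t :: real and x
  assume t: "t > 0"
  have "inverse t * (INF q\<in>C. q (t *\<^sub>R x)) \<le> (INF q\<in>C. q x)"
  proof (rule cINF_greatest[OF C(1)])
    fix q assume q: "q \<in> C"
    have "(INF q\<in>C. q (t *\<^sub>R x)) \<le> t * q x"
      using cINF_lower[OF bdd q, of "t *\<^sub>R x"] sublinear_scaleR[OF C(2)[OF q] t] by simp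
    then show "inverse t * (INF q\<in>C. q (t *\<^sub>R x)) \<le> q x"
      using t by (simp add: field_simps)
  qed
  then show "(INF q\<in>C. q (t *\<^sub>R x)) \<le> t * (INF q\<in>C. q x)"
    using t by (simp add: field_simps)
qed

text \<open>The infimum of \<open>p (x + t *\<^sub>R y) - t * p y\<close> over
  \<open>t \<ge> 0\<close> works: \<open>t = 0\<close> gives \<open>q \<le> p\<close>,
  \<open>t = 1\<close> gives the third claim, and the third claim at \<open>- y\<close> gives the
  last.\<close>

lemma sublinear_decrease:
  assumes p: "sublinear p"
  obtains q where "sublinear q" "q \<le> p" "\<And>x. q x \<le> p (x + y) - p y" "q (- y) \<le> - p y"
proof
  define q where "q = (\<lambda>x. INF t\<in>{0..}. p (x + t *\<^sub>R y) - t * p y)"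
  have hom: "p (t *\<^sub>R y) = t * p y" if "t \<ge> 0" for t
    using that sublinear_scaleR[OF p, of t y] sublinear_zero[OF p] by (cases "t = 0") auto
  \<comment> \<open>A lower bound independent of \<open>t\<close>, so the infimum is finite.\<close>
  have "- p (- x) \<le> p (x + t *\<^sub>R y) - t * p y" if "t \<ge> 0" for t x
    using sublinear_add[OF p, of "x + t *\<^sub>R y" "- x"] hom[OF that] by simp
  then have bdd: "bdd_below ((\<lambda>t. p (x + t *\<^sub>R y) - t * p y) ` {0..})" for x
    by (intro bdd_belowI[of _ "- p (- x)"]) auto
  have le: "q x \<le> p (x + t *\<^sub>R y) - t * p y" if "t \<ge> 0" for x t
    unfolding q_def using that by (intro cINF_lower[OF bdd]) auto
  have ge: "c \<le> q x" if "\<And>t. t \<ge> 0 \<Longrightarrow> c \<le> p (x + t *\<^sub>R y) - t * p y" for c x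
    unfolding q_def using that by (intro cINF_greatest) auto
  show "sublinear q"
    unfolding sublinear_def
  proof (intro conjI allI impI)
    fix a b
    have *: "q (a + b) \<le> (p (a + s *\<^sub>R y) - s * p y) + (p (b + t *\<^sub>R y) - t * p y)"
      if "s \<ge> 0" "t \<ge> 0" for s t
    proof -
      have "q (a + b) \<le> p ((a + s *\<^sub>R y) + (b + t *\<^sub>R y)) - (s + t) * p y"
        using le[of "s + t" "a + b"] that by (simp add: algebra_simps)
      with sublinear_add[OF p, of "a + s *\<^sub>R y" "b + t *\<^sub>R y"] show ?thesis
        by (simp add: algebra_simps)
    qed
    have "q (a + b) - (p (b + t *\<^sub>R y) - t * p y) \<le> q a" if "t \<ge> 0" for t
      by (rule ge) (use *[OF _ that] in \<open>simp add: algebra_simps\<close>)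
    then have "q (a + b) - q a \<le> q b"
      by (intro ge) (simp add: algebra_simps)
    then show "q (a + b) \<le> q a + q b" by simp
  next
    fix t :: real and x
    assume t: "t > 0"
    have "inverse t * q (t *\<^sub>R x) \<le> q x"
    proof (rule ge)
      fix s :: real assume s: "s \<ge> 0"
      have "q (t *\<^sub>R x) \<le> p (t *\<^sub>R (x + s *\<^sub>R y)) - (t * s) * p y"
        using le[of "t * s" "t *\<^sub>R x"] s t by (simp add: algebra_simps)
      also have "\<dots> = t * (p (x + s *\<^sub>R y) - s * p y)"
        by (simp only: sublinear_scaleR[OF p t] right_diff_distrib mult.assoc)
      finally show "inverse t * q (t *\<^sub>R x) \<le> p (x + s *\<^sub>R y) - s * p y"
        using t by (simp add: field_simps)
    qed
    then show "q (t *\<^sub>R x) \<le> t * q x"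
      using t by (simp add: field_simps)
  qed
  show "q \<le> p"
    using le[of 0] by (simp add: le_fun_def)
  show "q x \<le> p (x + y) - p y" for x
    using le[of 1 x] by simp
  from this[of "- y"] show "q (- y) \<le> - p y"
    by (simp add: sublinear_zero[OF p])
qed

text \<open>A minimal sublinear functional is linear, so no one-dimensional extension step is
  needed.\<close>

lemma linear_below_sublinear:
  assumes p: "sublinear p"
  obtains f where "linear f" "f \<le> p"
proof -
  define A where "A = {q. sublinear q \<and> q \<le> p}"
  \<comment> \<open>Zorn's lemma is applied to the reversed order and so yields a minimal
    element.\<close>
  have "\<exists>m\<in>A. \<forall>a\<in>A. m \<ge> a \<longrightarrow> a = m"
  proof (rule predicate_Zorn)
    show "partial_order_on A (relation_of (\<ge>) A)"
      by (rule partial_order_on_relation_ofI) auto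
    fix C assume "C \<in> Chains (relation_of (\<ge>) A)"
    then have C: "C \<subseteq> A" and dir: "\<And>q r. q \<in> C \<Longrightarrow> r \<in> C \<Longrightarrow> q \<le> r \<or> r \<le> q"
      by (auto simp: Chains_def relation_of_def)
    show "\<exists>u\<in>A. \<forall>a\<in>C. a \<ge> u"
    proof (cases "C = {}")
      case True
      with p show ?thesis by (auto simp: A_def)
    next
      case False
      have sub: "sublinear q" "q \<le> p" if "q \<in> C" for q
        using C that by (auto simp: A_def)
      have "- p (- x) \<le> q x" if "q \<in> C" for q x
        using sublinear_ge_uminus[OF sub(1)[OF that], of x] sub(2)[OF that]
        by (smt (verit) le_funD)
      then have bdd: "bdd_below ((\<lambda>q. q x) ` C)" for x
        by (intro bdd_belowI[of _ "- p (- x)"]) auto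
      have lower: "(\<lambda>x. INF q\<in>C. q x) \<le> q" if "q \<in> C" for q
        by (auto simp: le_fun_def intro!: cINF_lower bdd that)
      obtain q where "q \<in> C" using False by blast
      then have "(\<lambda>x. INF q\<in>C. q x) \<le> p"
        using lower sub(2) order_trans by blast
      moreover have "sublinear (\<lambda>x. INF q\<in>C. q x)"
        using sublinear_directed_INF False sub(1) dir bdd by blast
      ultimately show ?thesis
        using lower unfolding A_def by blast
    qed
  qed
  then obtain m where m: "sublinear m" "m \<le> p" and min: "\<And>a. sublinear a \<Longrightarrow> a \<le> m \<Longrightarrow> a = m"
    unfolding A_def using order_trans by blast
  \<comment> \<open>By minimality the decreased functional is \<open>m\<close> itself, whence
    \<open>m x + m y \<le> m (x + y)\<close>; subadditivity is the converse.\<close>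
  have add: "m (x + y) = m x + m y" for x y
  proof -
    obtain q where q: "sublinear q" "q \<le> m" "\<And>x. q x \<le> m (x + y) - m y"
      using sublinear_decrease[OF m(1)] by metis
    from min[OF q(1,2)] q(3)[of x] sublinear_add[OF m(1), of x y] show ?thesis
      by simp
  qed
  have "linear m"
  proof (rule linearI)
    fix r :: real and x
    consider "r > 0" | "r = 0" | "r < 0" by linarith
    then show "m (r *\<^sub>R x) = r *\<^sub>R m x"
    proof cases
      case 3
      have "m (r *\<^sub>R x) + m ((- r) *\<^sub>R x) = 0"
        using add[of "r *\<^sub>R x" "(- r) *\<^sub>R x"] sublinear_zero[OF m(1)] by simp
      moreover have "m ((- r) *\<^sub>R x) = (- r) * m x"
        using 3 by (intro sublinear_scaleR[OF m(1)]) simp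
      ultimately show ?thesis by simp
    qed (use sublinear_scaleR[OF m(1)] sublinear_zero[OF m(1)] in auto)
  qed (rule add)
  with m(2) that show thesis by blast
qed

text \<open>Decreasing \<open>p\<close> first forces every linear \<open>f\<close> below the result
  to satisfy \<open>f (- y) \<le> - p y\<close>, which is the missing inequality
  \<open>p y \<le> f y\<close>.\<close>

lemma hahn_banach_sublinear:
  assumes p: "sublinear p"
  obtains f where "linear f" "\<And>x. f x \<le> p x" "f y = p y"
proof -
  obtain q where q: "sublinear q" "q \<le> p" "q (- y) \<le> - p y"
    using sublinear_decrease[OF p] by metis
  obtain f where f: "linear f" "f \<le> q"
    using linear_below_sublinear[OF q(1)] by blast
  have le: "f x \<le> p x" for x
    using f(2) q(2) by (meson le_funD order_trans)
  have "f (- y) \<le> - p y"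
    using f(2) q(3) by (meson le_funD order_trans)
  then have "f y = p y"
    using le[of y] linear_neg[OF f(1), of y] by simp
  with f(1) le that show thesis by blast
qed

section \<open>Linear systems of norm inequalities in the bidual\<close>

lemma bounded_bilinear_scaleC:
  "bounded_bilinear (scaleC :: complex \<Rightarrow> 'a \<Rightarrow> 'a::complex_normed_vector)"
proof
  show "(r *\<^sub>R c) *\<^sub>C x = r *\<^sub>R (c *\<^sub>C x)" "c *\<^sub>C (r *\<^sub>R x) = r *\<^sub>R (c *\<^sub>C x)"
    for r c and x :: 'a
    by (simp_all add: scaleC_scaleC scaleR_conv_of_real mult.commute flip: scaleC_of_real)
  show "\<exists>K. \<forall>c (x::'a). norm (c *\<^sub>C x) \<le> norm c * norm x * K"
    by (intro exI[of _ 1]) (simp add: norm_scaleC)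
qed (simp_all add: scaleC_add_left scaleC_add_right)

interpretation scaleC: bounded_bilinear "scaleC :: complex \<Rightarrow> 'a \<Rightarrow> 'a::complex_normed_vector"
  by (rule bounded_bilinear_scaleC)

lemma scaleC_one [simp]: "1 *\<^sub>C (x::'a::complex_normed_vector) = x"
  using scaleC_of_real[of 1 x] by simp

lemma bounded_linear_cdual_apply: "bounded_linear (cdual_apply f)"
  by transfer (rule blinfun.bounded_linear_right)

lemmas cdual_apply_sum_right = linear_sum[OF bounded_linear.linear[OF bounded_linear_cdual_apply]]
  and cdual_apply_zero_right = linear_0[OF bounded_linear.linear[OF bounded_linear_cdual_apply]]
  and cdual_apply_sum_left = linear_sum[OF bounded_linear.linear[OF bounded_linear_cdual_eval]]
  and cdual_apply_zero_left = linear_0[OF bounded_linear.linear[OF bounded_linear_cdual_eval]]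
  and cdual_apply_diff_left = linear_diff[OF bounded_linear.linear[OF bounded_linear_cdual_eval]]
  and cdual_apply_scaleR_right = linear_scale[OF bounded_linear.linear[OF bounded_linear_cdual_apply]]

lemma norm_cdual_bound:
  assumes "0 \<le> b" "\<And>x. norm (cdual_apply f x) \<le> b * norm x"
  shows "norm f \<le> b"
  using assms by transfer (rule norm_blinfun_bound)

lemma cdual_apply_exI:
  assumes "\<And>x y. g (x + y) = g x + g y" "\<And>c x. g (c *\<^sub>C x) = c * g x"
    and "\<And>x. norm (g x) \<le> norm x * K"
  obtains f where "cdual_apply f = g"
proof
  have "bounded_linear g"
  proof (rule bounded_linear_intro[OF assms(1) _ assms(3)])
    show "g (r *\<^sub>R x) = r *\<^sub>R g x" for r x
      by (simp add: assms(2) scaleR_conv_of_real flip: scaleC_of_real)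
  qed
  then show "cdual_apply (Abs_cdual (Blinfun g)) = g"
    by (simp add: cdual_apply.rep_eq Abs_cdual_inverse bounded_linear_Blinfun_apply assms(2))
qed

text \<open>If all values on the unit ball were below \<open>t * norm f\<close>, homogeneity would
  give \<open>norm f \<le> t * norm f\<close>, while the value at 0 shows
  \<open>norm f > 0\<close>.\<close>

lemma norm_cdual_almost_attained:
  assumes "0 \<le> t" "t < 1"
  shows "\<exists>x. norm x \<le> 1 \<and> t * norm f \<le> norm (cdual_apply f x)"
proof (rule ccontr)
  assume "\<not> ?thesis"
  then have *: "norm (cdual_apply f x) < t * norm f" if "norm x \<le> 1" for x
    using that not_le by blast
  have "norm f \<le> t * norm f"
  proof (rule norm_cdual_bound)
    fix x
    show "norm (cdual_apply f x) \<le> t * norm f * norm x"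
    proof (cases "x = 0")
      case False
      have "norm (cdual_apply f (inverse (norm x) *\<^sub>R x)) < t * norm f"
        by (rule *) (simp add: False)
      then show ?thesis
        using False by (simp add: cdual_apply_scaleR_right field_simps)
    qed (simp add: cdual_apply_zero_right)
  qed (use assms in simp)
  moreover have "t * norm f < norm f"
    using *[of 0] assms by (simp add: cdual_apply_zero_right zero_less_mult_iff)
  ultimately show False by simp
qed

text \<open>The functional is \<open>g x - \<i> * g (\<i> *\<^sub>C x)\<close>. The factor 2 in its
  norm bound is crude but gives continuity; the norms are estimated later for all functionals of a
  system together.\<close>

lemma complex_linear_from_real_part:
  fixes g :: "'a::complex_normed_vector \<Rightarrow> real"
  assumes "linear g" and bound: "\<And>x. \<bar>g x\<bar> \<le> norm x"
  obtains f where "\<And>x. Re (cdual_apply f x) = g x"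
proof -
  interpret linear g by fact
  define h where "h x = Complex (g x) (- g (\<i> *\<^sub>C x))" for x
  have g_scaleC: "g (c *\<^sub>C x) = Re c * g x + Im c * g (\<i> *\<^sub>C x)" for c x
  proof -
    have "c *\<^sub>C x = Re c *\<^sub>R x + Im c *\<^sub>R (\<i> *\<^sub>C x)"
      by (simp add: scaleC_scaleC flip: scaleC_of_real scaleC_add_left)
        (simp add: mult.commute complex_eq[symmetric])
    then show ?thesis by (simp only: add scale real_scaleR_def)
  qed
  have "h (c *\<^sub>C x) = c * h x" for c x
    using g_scaleC[of c x] g_scaleC[of "\<i> * c" x]
    by (simp add: h_def complex_eq_iff scaleC_scaleC)
  moreover have "h (x + y) = h x + h y" for x y
    by (simp add: h_def complex_eq_iff add scaleC_add_right)
  moreover have "norm (h x) \<le> norm x * 2" for x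
  proof -
    have "norm (h x) \<le> \<bar>g x\<bar> + \<bar>g (\<i> *\<^sub>C x)\<bar>"
      using cmod_le[of "h x"] by (simp add: h_def)
    also have "\<dots> \<le> norm x * 2"
      using bound[of x] bound[of "\<i> *\<^sub>C x"] by (simp add: norm_scaleC)
    finally show ?thesis .
  qed
  ultimately obtain f where "cdual_apply f = h"
    using cdual_apply_exI by blast
  then show thesis
    using that[of f] by (simp add: h_def)
qed

lemma sum_fun_apply: "(\<Sum>x\<in>A. f x) y = (\<Sum>x\<in>A. f x y)"
  by (induction A rule: infinite_finite_induct) auto

text \<open>Duality: if no \<open>d\<close> exists, the family \<open>\<xi>\<close> has distance at
  least 1 from the range of \<open>S\<close>, and Hahn--Banach separates it by functionals
  \<open>G k\<close> whose combinations with the weights \<open>a k j\<close> vanish. Pairing the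
  bidual family with the \<open>G k\<close> therefore removes the \<open>c j\<close> and leaves a
  value with real part at least 1, although the norms of the \<open>G k\<close> sum to about 1 at
  most and the bidual vectors have norms below 1.\<close>

lemma bidual_system_solvable_unit:
  fixes a :: "'i \<Rightarrow> 'j \<Rightarrow> complex" and \<xi> :: "'i \<Rightarrow> 'a::complex_normed_vector"
    and c :: "'j \<Rightarrow> 'a cdual cdual"
  assumes I: "finite I" and J: "finite J"
    and less: "\<And>k. k \<in> I \<Longrightarrow> norm (canonical_embedding (\<xi> k) + (\<Sum>j\<in>J. a k j *\<^sub>C c j)) < 1"
  shows "\<exists>d. \<forall>k\<in>I. norm (\<xi> k + (\<Sum>j\<in>J. a k j *\<^sub>C d j)) < 1"
proof (cases "I = {}")
  case False
  \<comment> \<open>\<open>N\<close> sees only the coordinates in \<open>I\<close>, so it is a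
    seminorm; \<open>p\<close> is the quotient seminorm modulo the range of
    \<open>S\<close>.\<close>
  define N where "N z = Max ((\<lambda>k. norm (z k)) ` I)" for z :: "'i \<Rightarrow> 'a"
  define S where "S d = (\<lambda>k. \<Sum>j\<in>J. a k j *\<^sub>C d j)" for d :: "'j \<Rightarrow> 'a"
  define p where "p z = (INF d. N (z + S d))" for z
  have N_ge: "norm (z k) \<le> N z" if "k \<in> I" for z k
    unfolding N_def using I that by (intro Max_ge) auto
  have N_le: "N z \<le> r" if "\<And>k. k \<in> I \<Longrightarrow> norm (z k) \<le> r" for z r
    unfolding N_def using I False that by (intro Max.boundedI) auto
  have N_nonneg: "0 \<le> N z" for z
    using False N_ge norm_ge_zero order_trans by blast
  have bdd: "bdd_below (range (\<lambda>d. N (z + S d)))" for z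
    using N_nonneg by (intro bdd_belowI[of _ 0]) auto
  have p_le: "p z \<le> N (z + S d)" for z d
    unfolding p_def by (intro cINF_lower bdd) simp
  have p_ge: "r \<le> p z" if "\<And>d. r \<le> N (z + S d)" for z r
    unfolding p_def using that by (intro cINF_greatest) auto
  have S_add: "S (d + e) = S d + S e" for d e
    by (simp add: S_def fun_eq_iff scaleC_add_right sum.distrib)
  have S_scaleR: "S (t *\<^sub>R d) = t *\<^sub>R S d" for t d
    by (simp add: S_def fun_eq_iff scaleR_fun_def scaleC.scaleR_right scaleR_sum_right)
  have S_zero: "S 0 = 0"
    by (simp add: S_def fun_eq_iff scaleC.zero_right)
  have N_add: "N (z + w) \<le> N z + N w" for z w
    by (intro N_le) (auto intro!: norm_triangle_mono N_ge)
  have sub: "sublinear p"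
    unfolding sublinear_def
  proof (intro conjI allI impI)
    fix z w
    have *: "p (z + w) \<le> N (z + S d) + N (w + S e)" for d e
      using p_le[of "z + w" "d + e"] N_add[of "z + S d" "w + S e"]
      by (simp add: S_add algebra_simps)
    have "p (z + w) - N (w + S e) \<le> p z" for e
      by (rule p_ge) (use * in \<open>simp add: algebra_simps\<close>)
    then have "p (z + w) - p z \<le> p w"
      by (intro p_ge) (simp add: algebra_simps)
    then show "p (z + w) \<le> p z + p w" by simp
  next
    fix t :: real and z
    assume t: "t > 0"
    have "inverse t * p (t *\<^sub>R z) \<le> p z"
    proof (rule p_ge)
      fix d
      have "p (t *\<^sub>R z) \<le> N (t *\<^sub>R (z + S d))"
        using p_le[of "t *\<^sub>R z" "t *\<^sub>R d"] by (simp only: S_scaleR scaleR_add_right)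
      also have "\<dots> \<le> t * N (z + S d)"
      proof (rule N_le)
        fix k assume "k \<in> I"
        then show "norm ((t *\<^sub>R (z + S d)) k) \<le> t * N (z + S d)"
          using N_ge[of k "z + S d"] t by (simp add: scaleR_fun_def)
      qed
      finally show "inverse t * p (t *\<^sub>R z) \<le> N (z + S d)"
        using t by (simp add: field_simps)
    qed
    then show "p (t *\<^sub>R z) \<le> t * p z"
      using t by (simp add: field_simps)
  qed
  show ?thesis
  proof (rule ccontr)
    assume neg: "\<not> ?thesis"
    have "1 \<le> p \<xi>"
    proof (rule p_ge)
      fix d
      obtain k where "k \<in> I" "1 \<le> norm (\<xi> k + (\<Sum>j\<in>J. a k j *\<^sub>C d j))"
        using neg not_less by blast
      then show "1 \<le> N (\<xi> + S d)"
        using N_ge[of k "\<xi> + S d"] by (simp add: S_def)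
    qed
    then obtain f where f: "linear f" "\<And>z. f z \<le> p z" "1 \<le> f \<xi>"
      using hahn_banach_sublinear[OF sub, of \<xi>] by metis
    interpret f: linear f by (rule f(1))
    have f_le: "f z \<le> N z" for z
      using f(2)[of z] p_le[of z 0] by (simp add: S_zero)
    have f_abs: "\<bar>f z\<bar> \<le> N z" for z
      using f_le[of z] f_le[of "- z"] by (simp add: f.neg N_def)
    \<comment> \<open>Since \<open>- d\<close> cancels \<open>d\<close>, \<open>p\<close> is at most
      0 on the range of \<open>S\<close>; the signs \<open>d\<close> and \<open>- d\<close> together
      make \<open>f\<close> vanish there.\<close>
    have f_S: "f (S d) = 0" for d
    proof -
      have "f (S d) \<le> 0" for d
      proof -
        have "N (S d + S (- 1 *\<^sub>R d)) = 0"
          unfolding S_scaleR using False I by (simp add: N_def)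
        then show ?thesis
          using f(2)[of "S d"] p_le[of "S d" "- 1 *\<^sub>R d"] by simp
      qed
      from this[of d] and this[of "- 1 *\<^sub>R d"] show ?thesis
        unfolding S_scaleR by (simp add: f.neg)
    qed
    define sg where "sg i v = (\<lambda>i'. if i' = i then v else 0)" for i :: 'i and v :: 'a
    define g where "g i v = f (sg i v)" for i v
    \<comment> \<open>The difference of \<open>z\<close> and the sum of its components vanishes on
      \<open>I\<close>, hence has \<open>N\<close>-value 0 and is killed by
      \<open>f\<close>.\<close>
    have f_sum: "f z = (\<Sum>k\<in>I. g k (z k))" for z
    proof -
      have "(z - (\<Sum>k\<in>I. sg k (z k))) k = 0" if "k \<in> I" for k
        using that I by (simp add: sum_fun_apply sg_def)
      then have "N (z - (\<Sum>k\<in>I. sg k (z k))) \<le> 0"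
        by (intro N_le) simp
      then have "f (z - (\<Sum>k\<in>I. sg k (z k))) = 0"
        using f_abs[of "z - (\<Sum>k\<in>I. sg k (z k))"] by linarith
      then show ?thesis by (simp add: f.diff f.sum g_def)
    qed
    have "\<exists>G. \<forall>x. Re (cdual_apply G x) = g k x" if "k \<in> I" for k
    proof -
      have "linear (g k)"
      proof (rule linearI)
        have "sg k (u + v) = sg k u + sg k v" "sg k (r *\<^sub>R u) = r *\<^sub>R sg k u" for u v r
          by (auto simp: sg_def scaleR_fun_def)
        then show "g k (u + v) = g k u + g k v" "g k (r *\<^sub>R u) = r *\<^sub>R g k u" for u v r
          by (simp_all add: g_def f.add f.scale)
      qed
      moreover have "\<bar>g k x\<bar> \<le> norm x" for x
      proof -
        have "\<bar>g k x\<bar> \<le> N (sg k x)"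
          unfolding g_def by (rule f_abs)
        also have "\<dots> \<le> norm x"
          by (rule N_le) (simp add: sg_def)
        finally show ?thesis .
      qed
      ultimately show ?thesis
        using complex_linear_from_real_part by metis
    qed
    then obtain G where G: "\<And>k x. k \<in> I \<Longrightarrow> Re (cdual_apply (G k) x) = g k x"
      by metis
    \<comment> \<open>Families \<open>d\<close> supported at \<open>j\<close> show that the real
      part vanishes at every \<open>x\<close>; replacing \<open>x\<close> by
      \<open>\<i> *\<^sub>C x\<close> handles the imaginary part.\<close>
    have G_zero: "(\<Sum>k\<in>I. a k j *\<^sub>C G k) = 0" if j: "j \<in> J" for j
    proof -
      let ?H = "\<Sum>k\<in>I. a k j *\<^sub>C G k"
      have Re0: "Re (cdual_apply ?H x) = 0" for x
      proof -
        have "Re (cdual_apply ?H x) = (\<Sum>k\<in>I. g k (a k j *\<^sub>C x))"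
          by (simp add: cdual_apply_sum_left cdual_apply_linear flip: G)
        also have "\<dots> = f (S (\<lambda>j'. if j' = j then x else 0))"
        proof -
          have "S (\<lambda>j'. if j' = j then x else 0) k = a k j *\<^sub>C x" for k
            using j J by (simp add: S_def if_distrib scaleC.zero_right cong: if_cong)
          then show ?thesis by (simp add: f_sum)
        qed
        finally show ?thesis by (simp add: f_S)
      qed
      show ?thesis
      proof (rule cdual_eqI)
        fix x
        show "cdual_apply ?H x = cdual_apply 0 x"
          using Re0[of x] Re0[of "\<i> *\<^sub>C x"]
          by (simp add: cdual_apply_linear complex_eq_iff cdual_apply_zero_left)
      qed
    qed
    define F where "F k = canonical_embedding (\<xi> k) + (\<Sum>j\<in>J. a k j *\<^sub>C c j)" for k
    define \<theta> where "\<theta> = Max (norm ` F ` I)"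
    have \<theta>: "norm (F k) \<le> \<theta>" if "k \<in> I" for k
      unfolding \<theta>_def using that I by (intro Max_ge) auto
    have "\<theta> \<in> norm ` F ` I"
      unfolding \<theta>_def using I False by (intro Max_in) auto
    then have \<theta>01: "0 \<le> \<theta>" "\<theta> < 1"
      using less by (auto simp: F_def)
    have "(\<Sum>k\<in>I. cdual_apply (F k) (G k)) =
        (\<Sum>k\<in>I. cdual_apply (G k) (\<xi> k)) + (\<Sum>k\<in>I. \<Sum>j\<in>J. a k j * cdual_apply (c j) (G k))"
      by (simp add: F_def cdual_apply_linear canonical_embedding_apply cdual_apply_sum_left sum.distrib)
    also have "(\<Sum>k\<in>I. \<Sum>j\<in>J. a k j * cdual_apply (c j) (G k)) =
        (\<Sum>j\<in>J. cdual_apply (c j) (\<Sum>k\<in>I. a k j *\<^sub>C G k))"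
      by (subst sum.swap) (simp add: cdual_apply_sum_right cdual_apply_linear)
    also have "\<dots> = 0"
      by (simp add: G_zero cdual_apply_zero_right)
    finally have "Re (\<Sum>k\<in>I. cdual_apply (F k) (G k)) = f \<xi>"
      by (simp add: f_sum G)
    then have "1 \<le> norm (\<Sum>k\<in>I. cdual_apply (F k) (G k))"
      using f(3) complex_Re_le_cmod[of "\<Sum>k\<in>I. cdual_apply (F k) (G k)"] by linarith
    also have "\<dots> \<le> (\<Sum>k\<in>I. \<theta> * norm (G k))"
      by (intro order.trans[OF norm_sum] sum_mono order.trans[OF norm_cdual_apply]
          mult_right_mono \<theta>) auto
    finally have one_le: "1 \<le> \<theta> * (\<Sum>k\<in>I. norm (G k))"
      by (simp add: sum_distrib_left)
    \<comment> \<open>The norms of the \<open>G k\<close> need not be attained; finiteness of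
      \<open>I\<close> gives \<open>\<theta> < 1\<close> and thus room for a loss factor
      \<open>t\<close> between \<open>\<theta>\<close> and 1.\<close>
    define t where "t = (1 + \<theta>) / 2"
    have t: "0 \<le> t" "t < 1" "\<theta> < t"
      using \<theta>01 by (auto simp: t_def)
    have "\<forall>k. \<exists>x. norm x \<le> 1 \<and> t * norm (G k) \<le> norm (cdual_apply (G k) x)"
      by (simp add: norm_cdual_almost_attained t)
    then obtain v where v: "\<And>k. norm (v k) \<le> 1"
        "\<And>k. t * norm (G k) \<le> norm (cdual_apply (G k) (v k))"
      by metis
    \<comment> \<open>Rotating \<open>v k\<close> makes each \<open>cdual_apply (G k) (u k)\<close>
      real and nonnegative, so the absolute values add up to
      \<open>f u \<le> N u \<le> 1\<close>.\<close>
    define u where "u k = cnj (sgn (cdual_apply (G k) (v k))) *\<^sub>C v k" for k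
    have "t * (\<Sum>k\<in>I. norm (G k)) \<le> (\<Sum>k\<in>I. norm (cdual_apply (G k) (v k)))"
      unfolding sum_distrib_left by (intro sum_mono v)
    also have "\<dots> = f u"
      unfolding f_sum
    proof (rule sum.cong)
      fix k assume k: "k \<in> I"
      have "cnj (sgn w) * w = norm w" for w :: complex
        using complex_norm_square[of w]
        by (cases "w = 0") (simp_all add: sgn_eq power2_eq_square field_simps)
      then have "cdual_apply (G k) (u k) = norm (cdual_apply (G k) (v k))"
        by (simp add: u_def cdual_apply_linear)
      then show "norm (cdual_apply (G k) (v k)) = g k (u k)"
        by (simp flip: G[OF k])
    qed simp
    also have "\<dots> \<le> N u" by (rule f_le)
    also have "\<dots> \<le> 1"
      using v(1) by (intro N_le) (simp add: u_def norm_scaleC norm_sgn)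
    finally have le_one: "t * (\<Sum>k\<in>I. norm (G k)) \<le> 1" .
    have "0 < (\<Sum>k\<in>I. norm (G k))"
      using one_le \<theta>01 by (smt (verit) mult_nonneg_nonpos)
    with t(3) have "\<theta> * (\<Sum>k\<in>I. norm (G k)) < t * (\<Sum>k\<in>I. norm (G k))"
      by simp
    with one_le le_one show False by simp
  qed
qed simp

lemma norm_canonical_embedding_le: "norm (canonical_embedding x) \<le> norm x"
proof (rule norm_cdual_bound)
  show "norm (cdual_apply (canonical_embedding x) f) \<le> norm x * norm f" for f
    using norm_cdual_apply[of f x] by (simp add: canonical_embedding_apply mult.commute)
qed simp

lemma canonical_embedding_linear:
  "canonical_embedding (x + y) = canonical_embedding x + canonical_embedding y"
  "canonical_embedding (c *\<^sub>C x) = c *\<^sub>C canonical_embedding x"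
  by (auto intro!: cdual_eqI simp: canonical_embedding_apply cdual_apply_linear)

lemma bounded_linear_canonical_embedding: "bounded_linear canonical_embedding"
proof (rule bounded_linear_intro[where K = 1])
  show "canonical_embedding (r *\<^sub>R x) = r *\<^sub>R canonical_embedding x" for r and x :: 'a
    by (simp add: canonical_embedding_linear flip: scaleC_of_real)
qed (simp_all add: canonical_embedding_linear norm_canonical_embedding_le)

lemma norm_inverse_scaleC_less_1_iff:
  "b > 0 \<Longrightarrow> norm (inverse (complex_of_real b) *\<^sub>C x) < 1 \<longleftrightarrow> norm x < b"
  by (simp add: norm_scaleC norm_inverse) (simp add: field_simps)

text \<open>Each inequality is divided by \<open>b k\<close>, which is positive because it exceeds a
  norm.\<close>

lemma bidual_system_solvable:
  fixes a :: "'i \<Rightarrow> 'j \<Rightarrow> complex" and \<xi> :: "'i \<Rightarrow> 'a::complex_normed_vector"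
    and c :: "'j \<Rightarrow> 'a cdual cdual"
  assumes I: "finite I" and J: "finite J"
    and less: "\<And>k. k \<in> I \<Longrightarrow> norm (canonical_embedding (\<xi> k) + (\<Sum>j\<in>J. a k j *\<^sub>C c j)) < b k"
  shows "\<exists>d. \<forall>k\<in>I. norm (\<xi> k + (\<Sum>j\<in>J. a k j *\<^sub>C d j)) < b k"
proof -
  have pos: "b k > 0" if "k \<in> I" for k
    using less[OF that] norm_ge_zero le_less_trans by blast
  let ?s = "\<lambda>k. inverse (complex_of_real (b k))"
  have "\<exists>d. \<forall>k\<in>I. norm (?s k *\<^sub>C \<xi> k + (\<Sum>j\<in>J. (?s k * a k j) *\<^sub>C d j)) < 1"
  proof (rule bidual_system_solvable_unit[OF I J, where c = c])
    fix k assume k: "k \<in> I"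
    have "norm (?s k *\<^sub>C (canonical_embedding (\<xi> k) + (\<Sum>j\<in>J. a k j *\<^sub>C c j))) < 1"
      by (simp add: norm_inverse_scaleC_less_1_iff pos less k)
    then show "norm (canonical_embedding (?s k *\<^sub>C \<xi> k) + (\<Sum>j\<in>J. (?s k * a k j) *\<^sub>C c j)) < 1"
      by (simp add: canonical_embedding_linear scaleC_add_right scaleC.sum_right scaleC_scaleC)
  qed
  then obtain d where d: "\<And>k. k \<in> I \<Longrightarrow>
      norm (?s k *\<^sub>C (\<xi> k + (\<Sum>j\<in>J. a k j *\<^sub>C d j))) < 1"
    by (auto simp: scaleC_add_right scaleC.sum_right scaleC_scaleC)
  then have "\<forall>k\<in>I. norm (\<xi> k + (\<Sum>j\<in>J. a k j *\<^sub>C d j)) < b k"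
    using norm_inverse_scaleC_less_1_iff pos by blast
  then show ?thesis by blast
qed

section \<open>Approximate local reflexivity\<close>

lemma norm_diff_sum_scaleC_le:
  fixes e :: "'j \<Rightarrow> 'a::complex_normed_vector"
  assumes "\<And>j. j \<in> J \<Longrightarrow> norm (l j - m j) \<le> \<eta>"
  shows "norm ((\<Sum>j\<in>J. l j *\<^sub>C e j) - (\<Sum>j\<in>J. m j *\<^sub>C e j)) \<le> \<eta> * (\<Sum>j\<in>J. norm (e j))"
  unfolding sum_subtractf[symmetric] scaleC.diff_left[symmetric] sum_distrib_left
  by (intro sum_norm_le) (simp add: norm_scaleC mult_right_mono assms)

text \<open>Coefficients bounded by \<open>R\<close> are approximated from a finite
  \<open>\<eta>\<close>-net of the disc, which leaves a finite system in the unknowns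
  \<open>J - K\<close>. Half of \<open>\<epsilon>\<close> goes into solving this system strictly,
  the other half into the approximation.\<close>

lemma approximate_local_reflexivity:
  fixes c :: "'j \<Rightarrow> 'a::complex_normed_vector cdual cdual" and x :: "'j \<Rightarrow> 'a"
  assumes J: "finite J" and K: "\<And>j. j \<in> J \<inter> K \<Longrightarrow> c j = canonical_embedding (x j)"
    and \<epsilon>: "\<epsilon> > 0"
  obtains d where "\<And>j. j \<in> J \<inter> K \<Longrightarrow> d j = x j"
    "\<And>l. (\<And>j. j \<in> J \<Longrightarrow> norm (l j) \<le> R) \<Longrightarrow>
        norm (\<Sum>j\<in>J. l j *\<^sub>C d j) \<le> norm (\<Sum>j\<in>J. l j *\<^sub>C c j) + \<epsilon>"
proof -
  \<comment> \<open>\<open>\<eta>\<close> must be fixed before \<open>d\<close> is known, so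
    \<open>B\<close> bounds the norms of the \<open>c j\<close> and the future \<open>d j\<close> in
    terms of \<open>c\<close> alone. The \<open>+ 1\<close> in \<open>\<eta>\<close> avoids division
    by zero.\<close>
  define B where "B = (\<Sum>j\<in>J. 2 * norm (c j) + \<epsilon>)"
  define \<eta> where "\<eta> = \<epsilon> / (2 * (B + 1))"
  have B: "B \<ge> 0"
    unfolding B_def using \<epsilon> by (intro sum_nonneg) (simp add: add_nonneg_nonneg)
  then have \<eta>: "\<eta> > 0" "\<eta> * B \<le> \<epsilon> / 2"
    using \<epsilon> by (auto simp: \<eta>_def field_simps)
  obtain F where F: "finite F" "cball (0::complex) R \<subseteq> (\<Union>z\<in>F. ball z \<eta>)"
    using compact_eq_totally_bounded[of "cball (0::complex) R"] \<eta>(1) by auto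
  \<comment> \<open>Adding 0 and 1 to the net admits unit coefficient families, from which the bound
    on each single \<open>d j\<close> follows.\<close>
  define I where "I = J \<rightarrow>\<^sub>E insert 0 (insert 1 F)"
  define \<xi> where "\<xi> l = (\<Sum>j\<in>J \<inter> K. l j *\<^sub>C x j)" for l
  have "\<exists>d. \<forall>l\<in>I. norm (\<xi> l + (\<Sum>j\<in>J - K. l j *\<^sub>C d j)) < norm (\<Sum>j\<in>J. l j *\<^sub>C c j) + \<epsilon> / 2"
  proof (rule bidual_system_solvable[where c = c])
    show "finite I"
      unfolding I_def using J F(1) by (intro finite_PiE) auto
    fix l
    have "canonical_embedding (\<xi> l) = (\<Sum>j\<in>J \<inter> K. l j *\<^sub>C c j)"
      by (simp add: \<xi>_def K canonical_embedding_linear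
          linear_sum[OF bounded_linear.linear[OF bounded_linear_canonical_embedding]])
    then show "norm (canonical_embedding (\<xi> l) + (\<Sum>j\<in>J - K. l j *\<^sub>C c j))
        < norm (\<Sum>j\<in>J. l j *\<^sub>C c j) + \<epsilon> / 2"
      using \<epsilon> sum.Int_Diff[OF J, of "\<lambda>j. l j *\<^sub>C c j" K] by simp
  qed (use J in simp)
  then obtain d' where d': "\<And>l. l \<in> I \<Longrightarrow>
      norm (\<xi> l + (\<Sum>j\<in>J - K. l j *\<^sub>C d' j)) < norm (\<Sum>j\<in>J. l j *\<^sub>C c j) + \<epsilon> / 2"
    by blast
  define d where "d j = (if j \<in> K then x j else d' j)" for j
  have d: "norm (\<Sum>j\<in>J. l j *\<^sub>C d j) \<le> norm (\<Sum>j\<in>J. l j *\<^sub>C c j) + \<epsilon> / 2" if "l \<in> I" for l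
  proof -
    have "(\<Sum>j\<in>J. l j *\<^sub>C d j) = \<xi> l + (\<Sum>j\<in>J - K. l j *\<^sub>C d' j)"
      unfolding sum.Int_Diff[OF J, of "\<lambda>j. l j *\<^sub>C d j" K] by (simp add: d_def \<xi>_def)
    then show ?thesis using d'[OF that] by simp
  qed
  have norm_d: "norm (d j) \<le> norm (c j) + \<epsilon>" if j: "j \<in> J" for j
  proof -
    define l where "l = restrict (\<lambda>i. if i = j then 1 else 0 :: complex) J"
    have "l \<in> I" unfolding l_def I_def by (rule restrict_PiE_iff[THEN iffD2]) simp
    moreover have "(\<Sum>i\<in>J. l i *\<^sub>C d i) = d j" "(\<Sum>i\<in>J. l i *\<^sub>C c i) = c j"
      using J j by (simp_all add: l_def if_distrib[of "\<lambda>t. scaleC t _"] scaleC.zero_left cong: if_cong)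
    ultimately show ?thesis using d[of l] \<epsilon> by simp
  qed
  show thesis
  proof
    show "d j = x j" if "j \<in> J \<inter> K" for j
      using that by (simp add: d_def)
    fix l :: "'j \<Rightarrow> complex" assume l: "\<And>j. j \<in> J \<Longrightarrow> norm (l j) \<le> R"
    have "\<exists>m\<in>F. norm (l j - m) \<le> \<eta>" if "j \<in> J" for j
    proof -
      have "l j \<in> (\<Union>z\<in>F. ball z \<eta>)"
        using F(2) l[OF that] by (auto simp: subset_iff)
      then show ?thesis
        by (auto simp: dist_norm norm_minus_commute intro: less_imp_le)
    qed
    then obtain m where m: "\<And>j. j \<in> J \<Longrightarrow> m j \<in> F" "\<And>j. j \<in> J \<Longrightarrow> norm (l j - m j) \<le> \<eta>"
      by metis
    have "restrict m J \<in> I"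
      using m(1) by (auto simp: I_def)
    from d[OF this] have "norm (\<Sum>j\<in>J. m j *\<^sub>C d j) \<le> norm (\<Sum>j\<in>J. m j *\<^sub>C c j) + \<epsilon> / 2"
      by simp
    moreover have "norm ((\<Sum>j\<in>J. l j *\<^sub>C d j) - (\<Sum>j\<in>J. m j *\<^sub>C d j)) \<le> \<eta> * (\<Sum>j\<in>J. norm (d j))"
      and "norm ((\<Sum>j\<in>J. l j *\<^sub>C c j) - (\<Sum>j\<in>J. m j *\<^sub>C c j)) \<le> \<eta> * (\<Sum>j\<in>J. norm (c j))"
      using m(2) by (intro norm_diff_sum_scaleC_le; blast)+
    moreover have "\<eta> * (\<Sum>j\<in>J. norm (d j)) + \<eta> * (\<Sum>j\<in>J. norm (c j)) \<le> \<eta> * B"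
    proof -
      have "(\<Sum>j\<in>J. norm (d j)) + (\<Sum>j\<in>J. norm (c j)) \<le> B"
        unfolding B_def sum.distrib[symmetric] by (intro sum_mono) (use norm_d in force)
      then show ?thesis
        using \<eta>(1) by (simp flip: distrib_left)
    qed
    ultimately show "norm (\<Sum>j\<in>J. l j *\<^sub>C d j) \<le> norm (\<Sum>j\<in>J. l j *\<^sub>C c j) + \<epsilon>"
      using \<eta>(2) norm_triangle_sub[of "\<Sum>j\<in>J. l j *\<^sub>C d j" "\<Sum>j\<in>J. m j *\<^sub>C d j"]
        norm_triangle_sub[of "\<Sum>j\<in>J. m j *\<^sub>C c j" "\<Sum>j\<in>J. l j *\<^sub>C c j"]
        norm_minus_commute[of "\<Sum>j\<in>J. m j *\<^sub>C c j" "\<Sum>j\<in>J. l j *\<^sub>C c j"]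
      by linarith
  qed
qed

section \<open>Discs in dual spaces\<close>

text \<open>Evaluation at \<open>x\<close> gives scalar holomorphic functions bounded by
  \<open>norm x\<close>. Their Taylor coefficients are linear in \<open>x\<close> and bounded by
  \<open>norm x\<close>, hence are functionals \<open>b n\<close>, and the remainder is dominated by
  a geometric tail uniformly in \<open>x\<close>.\<close>

lemma dual_disc_taylor:
  fixes f :: "complex \<Rightarrow> 'a::complex_normed_vector cdual"
  assumes f: "f \<in> holomorphic_maps (ball 0 1) (ball 0 1)"
  obtains b where
    "\<And>z N. norm z < 1 \<Longrightarrow> norm (f z - (\<Sum>n<N. z ^ n *\<^sub>C b n)) \<le> norm z ^ N / (1 - norm z)"
proof -
  define h where "h x z = cdual_apply (f z) x" for x z
  have holo: "h x holomorphic_on ball 0 1" for x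
    unfolding holomorphic_on_open[OF open_ball]
  proof
    fix z :: complex assume "z \<in> ball 0 1"
    then obtain L where L: "(f has_derivative L) (at z)" "\<And>c h. L (c *\<^sub>C h) = c *\<^sub>C L h"
      using f unfolding holomorphic_maps_def by blast
    have deriv: "(h x has_derivative (\<lambda>w. cdual_apply (L w) x)) (at z)"
      unfolding h_def by (rule bounded_linear.has_derivative[OF bounded_linear_cdual_eval L(1)])
    have mult: "cdual_apply (L w) x = cdual_apply (L 1) x * w" for w
      using arg_cong[OF L(2)[of w 1], of "\<lambda>g. cdual_apply g x"]
      by (simp add: scaleC_complex_def cdual_apply_linear)
    have "(\<lambda>w. cdual_apply (L w) x) = (*) (cdual_apply (L 1) x)"
      by (rule ext) (rule mult)
    with deriv have "(h x has_field_derivative cdual_apply (L 1) x) (at z)"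
      by (simp only: has_field_derivative_def)
    then show "\<exists>h'. (h x has_field_derivative h') (at z)" by blast
  qed
  have h_bound: "norm (h x z) \<le> norm x" if "norm z < 1" for x z
  proof -
    have "norm (f z) < 1"
      using f that unfolding holomorphic_maps_def by (auto simp: image_subset_iff)
    then show ?thesis
      using norm_cdual_apply[of "f z" x] mult_right_mono[of "norm (f z)" 1 "norm x"]
      by (simp add: h_def)
  qed
  define \<beta> where "\<beta> n x = (deriv ^^ n) (h x) 0 / fact n" for n x
  have \<beta>_bound: "norm (\<beta> n x) \<le> norm x" for n x
  proof -
    \<comment> \<open>Cauchy's estimate on radius \<open>r < 1\<close>; the factor
      \<open>r ^ n\<close> disappears in the limit \<open>r\<close> to 1.\<close>
    have "norm (\<beta> n x) * r ^ n \<le> norm x" if r: "0 < r" "r < 1" for r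
    proof -
      have "norm ((deriv ^^ n) (h x) 0) \<le> fact n * norm x / r ^ n"
      proof (rule Cauchy_inequality)
        show "h x holomorphic_on ball 0 r"
          using holo by (rule holomorphic_on_subset) (use r in auto)
        have "h x holomorphic_on cball 0 r"
          using holo by (rule holomorphic_on_subset) (use r in auto)
        then show "continuous_on (cball 0 r) (h x)"
          by (rule holomorphic_on_imp_continuous_on)
      qed (use r h_bound in auto)
      then show ?thesis
        using r by (simp add: \<beta>_def norm_divide field_simps)
    qed
    moreover have "((\<lambda>r. norm (\<beta> n x) * r ^ n) \<longlongrightarrow> norm (\<beta> n x) * 1 ^ n) (at_left 1)"
      by (intro tendsto_intros)
    moreover have "eventually (\<lambda>r::real. 0 < r \<and> r < 1) (at_left 1)"
      using eventually_at_left_real[of 0 1] by simp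
    ultimately show ?thesis
      by (intro tendsto_upperbound[where F = "at_left (1::real)" and f = "\<lambda>r. norm (\<beta> n x) * r ^ n"])
        (auto elim: eventually_mono)
  qed
  have "\<exists>g. cdual_apply g = \<beta> n" for n
  proof -
    have "h (x + y) = (\<lambda>z. h x z + h y z)" "h (c *\<^sub>C x) = (\<lambda>z. c * h x z)" for x y c
      by (auto simp: h_def cdual_apply_linear)
    then have "\<beta> n (x + y) = \<beta> n x + \<beta> n y" "\<beta> n (c *\<^sub>C x) = c * \<beta> n x" for x y c
      using higher_deriv_add[OF holo holo open_ball, of 0 n x y]
        higher_deriv_cmult[OF holo _ open_ball, of 0 n c x]
      by (auto simp: \<beta>_def add_divide_distrib)
    moreover have "norm (\<beta> n x) \<le> norm x * 1" for x
      using \<beta>_bound by simp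
    ultimately show ?thesis
      using cdual_apply_exI by metis
  qed
  then obtain b where b: "\<And>n x. cdual_apply (b n) x = \<beta> n x"
    by metis
  show thesis
  proof
    fix z :: complex and N assume z: "norm z < 1"
    show "norm (f z - (\<Sum>n<N. z ^ n *\<^sub>C b n)) \<le> norm z ^ N / (1 - norm z)"
    proof (rule norm_cdual_bound)
      fix x
      have "(\<lambda>n. \<beta> n x * z ^ n) sums h x z"
        using holomorphic_power_series[OF holo, of z x] z by (simp add: \<beta>_def)
      then have tail: "(\<lambda>n. \<beta> (n + N) x * z ^ (n + N)) sums (h x z - (\<Sum>n<N. \<beta> n x * z ^ n))"
        by (rule sums_split_initial_segment)
      have geom: "(\<lambda>n. norm x * norm z ^ N * norm z ^ n) sums (norm x * norm z ^ N * (1 / (1 - norm z)))"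
        using z by (intro sums_mult geometric_sums) simp
      have "norm (\<beta> (n + N) x * z ^ (n + N)) \<le> norm x * norm z ^ N * norm z ^ n" for n
        using mult_right_mono[OF \<beta>_bound[of "n + N" x], of "norm z ^ (n + N)"]
        by (simp add: norm_mult norm_power power_add mult_ac)
      from norm_suminf_le[OF this sums_summable[OF geom]]
      have "norm (h x z - (\<Sum>n<N. \<beta> n x * z ^ n)) \<le> norm x * norm z ^ N * (1 / (1 - norm z))"
        by (simp only: sums_unique[OF tail, symmetric] sums_unique[OF geom, symmetric])
      then show "norm (cdual_apply (f z - (\<Sum>n<N. z ^ n *\<^sub>C b n)) x) \<le> norm z ^ N / (1 - norm z) * norm x"
        by (simp add: cdual_apply_diff_left cdual_apply_sum_left cdual_apply_linear b h_def mult_ac)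
    qed (use z in simp)
  qed
qed

section \<open>The Poincare distance and the Lempert function\<close>

lemma poincare_quotient_less_1:
  assumes "norm u < 1" "norm v < 1"
  shows "norm ((u - v) / (1 - cnj v * u)) < 1"
  using Moebius_function_norm_lt_1[of v u 0] assms by (simp add: Moebius_function_simple)

lemma one_minus_cnj_mult_nonzero:
  assumes "norm u < 1" "norm v < 1"
  shows "1 - cnj v * u \<noteq> 0"
proof
  assume "1 - cnj v * u = 0"
  then have "norm v * norm u = 1"
    by (metis complex_mod_cnj eq_iff_diff_eq_0 norm_mult norm_one)
  moreover have "norm v * norm u < 1 * 1"
    using assms by (intro mult_strict_mono') auto
  ultimately show False by simp
qed

lemma poincare_dist_nonneg:
  assumes "norm u < 1" "norm v < 1"
  shows "0 \<le> poincare_dist u v"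
proof -
  define t where "t = norm ((u - v) / (1 - cnj v * u))"
  have "0 \<le> t" "t < 1"
    using poincare_quotient_less_1[OF assms] by (auto simp: t_def)
  then have "1 \<le> (1 + t) / (1 - t)" by simp
  then show ?thesis
    by (simp add: poincare_dist_def artanh_def flip: t_def)
qed

text \<open>Continuity as \<open>r\<close> tends to 1 from below. This lets a disc \<open>f\<close>
  be replaced by \<open>f (r * z)\<close>, which is defined beyond the closed unit disc and passes
  through the same points.\<close>

lemma poincare_dist_perturb:
  assumes uv: "norm u < 1" "norm v < 1" and e: "poincare_dist u v < e"
  obtains r where "0 < r" "r < 1" "norm u < r" "norm v < r"
    "poincare_dist (u / of_real r) (v / of_real r) < e"
proof -
  have "((\<lambda>r::real. poincare_dist (u / of_real r) (v / of_real r)) \<longlongrightarrow>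
      artanh (norm ((u / of_real 1 - v / of_real 1) / (1 - cnj (v / of_real 1) * (u / of_real 1)))))
      (at_left 1)"
    unfolding poincare_dist_def
    using poincare_quotient_less_1[OF uv] one_minus_cnj_mult_nonzero[OF uv]
    by (intro tendsto_intros) (auto intro: less_le_trans[OF _ norm_ge_zero])
  then have "\<forall>\<^sub>F r in at_left (1::real). poincare_dist (u / of_real r) (v / of_real r) < e"
    using e by (intro order_tendstoD(2)) (simp_all add: poincare_dist_def)
  moreover have "\<forall>\<^sub>F r in at_left (1::real). r \<in> {max 0 (max (norm u) (norm v))<..<1}"
    using uv by (intro eventually_at_left_real) auto
  ultimately have "\<forall>\<^sub>F r in at_left (1::real). 0 < r \<and> r < 1 \<and> norm u < r \<and> norm v < r \<and>
      poincare_dist (u / of_real r) (v / of_real r) < e"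
    by eventually_elim auto
  from eventually_happens'[OF trivial_limit_at_left_real this] show thesis
    using that by blast
qed

lemma lempert_fun_nonneg: "0 \<le> lempert_fun D p q"
  unfolding lempert_fun_def by (rule Inf_greatest) (auto simp: poincare_dist_nonneg)

lemma lempert_fun_le:
  assumes "norm u < 1" "norm v < 1" "f \<in> holomorphic_maps (ball 0 1) D" "f u = p" "f v = q"
  shows "lempert_fun D p q \<le> ereal (poincare_dist u v)"
  unfolding lempert_fun_def using assms by (intro Inf_lower) auto

lemma holomorphic_maps_const: "p \<in> D \<Longrightarrow> (\<lambda>z. p) \<in> holomorphic_maps S D"
  unfolding holomorphic_maps_def by (auto intro!: exI[of _ "\<lambda>h. 0"] simp: scaleC.zero_right)

text \<open>Distinct preimages \<open>u\<close> and \<open>v\<close> are needed to interpolate; for \<open>p = q\<close> they are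
  provided by a constant disc.\<close>

lemma lempert_fun_lessE:
  assumes "lempert_fun D p q < ereal e"
  obtains u v f where "norm u < 1" "norm v < 1" "u \<noteq> v" "poincare_dist u v < e"
    "f \<in> holomorphic_maps (ball 0 1) D" "f u = p" "f v = q"
proof -
  obtain u v f where uvf: "norm u < 1" "norm v < 1" "poincare_dist u v < e"
    "f \<in> holomorphic_maps (ball 0 1) D" "f u = p" "f v = q"
    using assms unfolding lempert_fun_def Inf_less_iff by auto
  show thesis
  proof (cases "u = v")
    case True
    then have "p = q" and e: "0 < e"
      using uvf by (auto simp: poincare_dist_def)
    have "p \<in> D"
      using uvf unfolding holomorphic_maps_def by (auto simp: image_subset_iff)
    \<comment> \<open>The point \<open>tanh (min e 1 / 2)\<close> differs from 0 and has Poincare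
      distance \<open>min e 1 / 2\<close> from it.\<close>
    have tanh: "0 < tanh (min e 1 / 2)" "tanh (min e 1 / 2) < 1"
      using e tanh_real_lt_1 by auto
    show thesis
    proof (rule that)
      show "poincare_dist (of_real (tanh (min e 1 / 2))) 0 < e"
        using e tanh by (simp add: poincare_dist_def artanh_tanh_real)
      show "(\<lambda>z. p) \<in> holomorphic_maps (ball 0 1) D"
        by (rule holomorphic_maps_const) fact
    qed (use tanh \<open>p = q\<close> in auto)
  next
    case False
    with uvf that show thesis by blast
  qed
qed

section \<open>Interpolating polynomial discs\<close>

text \<open>The polynomial \<open>\<Sum>j<N. z\<^sup>j a\<^sub>j\<close>, corrected by an affine map such that it takes the
  values \<open>p\<close> at \<open>u\<close> and \<open>q\<close> at \<open>v\<close>. For fixed \<open>z\<close> it is linear in \<open>p\<close>, \<open>q\<close> and the \<open>a\<^sub>j\<close>, with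
  scalar coefficients.\<close>

definition interp_poly ::
    "complex \<Rightarrow> complex \<Rightarrow> nat \<Rightarrow> 'a \<Rightarrow> 'a \<Rightarrow> (nat \<Rightarrow> 'a) \<Rightarrow> complex \<Rightarrow> 'a::complex_normed_vector"
  where "interp_poly u v N p q a z =
    ((v - z) / (v - u)) *\<^sub>C p + ((z - u) / (v - u)) *\<^sub>C q +
    (\<Sum>j<N. (z ^ j - (u ^ j * (v - z) + v ^ j * (z - u)) / (v - u)) *\<^sub>C a j)"

lemma interp_poly_nodes:
  assumes "u \<noteq> v"
  shows "interp_poly u v N p q a u = p" "interp_poly u v N p q a v = q"
  using assms by (simp_all add: interp_poly_def scaleC.zero_left)

text \<open>This form serves for estimates: the affine correction is small once the polynomial
  almost interpolates.\<close>

lemma interp_poly_alt: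
  assumes "u \<noteq> v"
  shows "interp_poly u v N p q a z = (\<Sum>j<N. z ^ j *\<^sub>C a j) +
    (((v - z) / (v - u)) *\<^sub>C (p - (\<Sum>j<N. u ^ j *\<^sub>C a j)) +
     ((z - u) / (v - u)) *\<^sub>C (q - (\<Sum>j<N. v ^ j *\<^sub>C a j)))"
proof -
  have "(z ^ j - (u ^ j * (v - z) + v ^ j * (z - u)) / (v - u)) *\<^sub>C a j =
      z ^ j *\<^sub>C a j - (((v - z) / (v - u)) *\<^sub>C u ^ j *\<^sub>C a j + ((z - u) / (v - u)) *\<^sub>C v ^ j *\<^sub>C a j)" for j
    by (simp add: scaleC.diff_left add_divide_distrib scaleC_add_left scaleC_scaleC mult.commute)
  then show ?thesis
    by (simp add: interp_poly_def sum_subtractf sum.distrib scaleC.diff_right scaleC.sum_right)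
qed

text \<open>By compactness a holomorphic disc has norm at most some \<open>M < 1\<close> on a
  smaller closed disc. After rescaling, its Taylor polynomials converge uniformly, so a late one,
  corrected at the two nodes, stays below \<open>(1 + M) / 2\<close>. The uniform gap to 1 is what
  local reflexivity consumes.\<close>

lemma dual_disc_interp_poly:
  fixes p q :: "'a::complex_normed_vector cdual"
  assumes "lempert_fun (ball 0 1) p q < ereal e"
  obtains u v N a M where "norm u < 1" "norm v < 1" "u \<noteq> v" "poincare_dist u v < e" "M < 1"
    "\<And>z. norm z < 1 \<Longrightarrow> norm (interp_poly u v N p q a z) \<le> M"
proof -
  obtain u v f where uv: "norm u < 1" "norm v < 1" "u \<noteq> v" "poincare_dist u v < e"
    and f: "f \<in> holomorphic_maps (ball 0 1) (ball 0 1)" "f u = p" "f v = q"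
    using lempert_fun_lessE[OF assms] by blast
  obtain r where r: "0 < r" "r < 1" "norm u < r" "norm v < r"
    "poincare_dist (u / of_real r) (v / of_real r) < e"
    using poincare_dist_perturb[OF uv(1,2,4)] by blast
  define s where "s = complex_of_real r"
  have s: "norm s = r" "s \<noteq> 0" using r by (auto simp: s_def)
  obtain M where M: "M < 1" "\<And>z. norm z \<le> r \<Longrightarrow> norm (f z) \<le> M"
  proof -
    have "continuous_on (cball 0 r) (\<lambda>z. norm (f z))"
    proof (intro continuous_on_norm continuous_at_imp_continuous_on ballI)
      fix z :: complex assume "z \<in> cball 0 r"
      then have "z \<in> ball (0::complex) 1" using r by auto
      then obtain L where "(f has_derivative L) (at z)"
        using f(1) unfolding holomorphic_maps_def by blast
      then show "isCont f z" by (rule has_derivative_continuous)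
    qed
    then obtain z0 where "z0 \<in> cball 0 r" "\<And>z. z \<in> cball 0 r \<Longrightarrow> norm (f z) \<le> norm (f z0)"
      using continuous_attains_sup[of "cball (0::complex) r" "\<lambda>z. norm (f z)"] r by fastforce
    moreover have "norm (f z0) < 1"
      using \<open>z0 \<in> cball 0 r\<close> f(1) r unfolding holomorphic_maps_def
      by (auto simp: image_subset_iff)
    ultimately show thesis using that by auto
  qed
  obtain b where b: "\<And>z N. norm z < 1 \<Longrightarrow> norm (f z - (\<Sum>n<N. z ^ n *\<^sub>C b n)) \<le> norm z ^ N / (1 - norm z)"
    using dual_disc_taylor[OF f(1)] by blast
  define a where "a j = s ^ j *\<^sub>C b j" for j
  have taylor: "norm (f (s * z) - (\<Sum>n<N. z ^ n *\<^sub>C a n)) \<le> r ^ N / (1 - r)" if "norm z \<le> 1" for z N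
  proof -
    have le: "norm (s * z) \<le> r" using that s r by (simp add: norm_mult)
    have "(\<Sum>n<N. z ^ n *\<^sub>C a n) = (\<Sum>n<N. (s * z) ^ n *\<^sub>C b n)"
      by (simp add: a_def scaleC_scaleC power_mult_distrib mult.commute)
    then have "norm (f (s * z) - (\<Sum>n<N. z ^ n *\<^sub>C a n)) \<le> norm (s * z) ^ N / (1 - norm (s * z))"
      using b[of "s * z" N] le r by simp
    also have "\<dots> \<le> r ^ N / (1 - r)"
      using le r by (intro frac_le power_mono) auto
    finally show ?thesis .
  qed
  define u' v' where "u' = u / s" and "v' = v / s"
  have u': "norm u' < 1" "norm v' < 1" "u' \<noteq> v'" "s * u' = u" "s * v' = v"
    using r uv(3) s by (auto simp: u'_def v'_def norm_divide)
  \<comment> \<open>One Taylor error at \<open>z\<close>, plus two node errors with weights at most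
    \<open>2 / norm (v' - u')\<close> each.\<close>
  define C where "C = 1 + 4 / norm (v' - u')"
  have C: "C > 0" using u' by (simp add: C_def add_pos_nonneg)
  have "(\<lambda>N. C * (r ^ N / (1 - r))) \<longlonglongrightarrow> C * (0 / (1 - r))"
    using r by (intro tendsto_intros LIMSEQ_power_zero) auto
  then have "\<forall>\<^sub>F N in sequentially. C * (r ^ N / (1 - r)) < (1 - M) / 2"
    using M(1) by (intro order_tendstoD(2)) auto
  then obtain N where N: "C * (r ^ N / (1 - r)) < (1 - M) / 2"
    using eventually_happens'[OF sequentially_bot] by blast
  define t where "t = r ^ N / (1 - r)"
  have t: "t \<ge> 0" "C * t < (1 - M) / 2" using r N by (auto simp: t_def)
  have "norm (interp_poly u' v' N p q a z) \<le> (1 + M) / 2" if z: "norm z < 1" for z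
  proof -
    let ?T = "\<lambda>z. \<Sum>n<N. z ^ n *\<^sub>C a n"
    have "norm (p - ?T u') \<le> t" "norm (q - ?T v') \<le> t" "norm (f (s * z) - ?T z) \<le> t"
      using taylor[of u' N] taylor[of v' N] taylor[of z N] u' z f by (simp_all add: t_def)
    note T = this
    have "norm (v' - z) \<le> 2" "norm (z - u') \<le> 2"
      using norm_triangle_ineq4[of v' z] norm_triangle_ineq4[of z u'] u' z by auto
    then have l: "norm ((v' - z) / (v' - u')) \<le> 2 / norm (v' - u')"
        "norm ((z - u') / (v' - u')) \<le> 2 / norm (v' - u')"
      by (simp_all add: norm_divide divide_right_mono)
    have "norm (?T z) \<le> norm (f (s * z)) + t"
      using T(3) norm_triangle_sub[of "?T z" "f (s * z)"] by (simp add: norm_minus_commute)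
    moreover have "norm (f (s * z)) \<le> M"
      using z s r by (intro M(2)) (simp add: norm_mult)
    moreover define k where "k = 2 / norm (v' - u') * t"
    have "norm (((v' - z) / (v' - u')) *\<^sub>C (p - ?T u')) \<le> k"
      "norm (((z - u') / (v' - u')) *\<^sub>C (q - ?T v')) \<le> k"
      unfolding norm_scaleC k_def by (intro mult_mono l T; simp)+
    moreover have "t + (k + k) = C * t"
      by (simp add: C_def k_def algebra_simps)
    moreover have "norm (interp_poly u' v' N p q a z) \<le> norm (?T z) +
        (norm (((v' - z) / (v' - u')) *\<^sub>C (p - ?T u')) + norm (((z - u') / (v' - u')) *\<^sub>C (q - ?T v')))"
      unfolding interp_poly_alt[OF u'(3)]
      by (intro order.trans[OF norm_triangle_ineq] add_mono order.refl norm_triangle_ineq)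
    ultimately have "norm (interp_poly u' v' N p q a z) \<le> M + C * t"
      by linarith
    also have "\<dots> \<le> M + (1 - M) / 2"
      using t(2) by linarith
    also have "\<dots> = (1 + M) / 2"
      by (simp add: field_simps)
    finally show ?thesis .
  qed
  then show thesis
    using that[of u' v' "(1 + M) / 2" N a] u' r(5) M(1) by (simp add: u'_def v'_def s_def)
qed

lemma has_derivative_scaleC_const:
  assumes "(g has_field_derivative g') (at z)"
  shows "((\<lambda>z. g z *\<^sub>C x) has_derivative (\<lambda>h. h *\<^sub>C g' *\<^sub>C x)) (at z)"
  using bounded_linear.has_derivative[OF scaleC.bounded_linear_left assms[unfolded has_field_derivative_def]]
  by (simp add: scaleC_scaleC mult.commute)

lemma interp_poly_holomorphic:
  assumes "\<And>z. z \<in> S \<Longrightarrow> interp_poly u v N p q a z \<in> D"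
  shows "interp_poly u v N p q a \<in> holomorphic_maps S D"
proof -
  have "\<exists>L. (interp_poly u v N p q a has_derivative L) (at z) \<and> (\<forall>c h. L (c *\<^sub>C h) = c *\<^sub>C L h)" for z
  proof -
    have "((\<lambda>z. (v - z) / (v - u)) has_field_derivative - 1 / (v - u)) (at z)"
      "((\<lambda>z. (z - u) / (v - u)) has_field_derivative 1 / (v - u)) (at z)"
      by (intro DERIV_cdivide; auto intro!: derivative_eq_intros)+
    note lin = this[THEN has_derivative_scaleC_const]
    \<comment> \<open>Only existence of this derivative matters, so \<open>deriv\<close> replaces an
      explicit formula.\<close>
    define e where "e j = deriv (\<lambda>z. z ^ j - (u ^ j * (v - z) + v ^ j * (z - u)) / (v - u)) z" for j
    have "((\<lambda>z. z ^ j - (u ^ j * (v - z) + v ^ j * (z - u)) / (v - u)) has_field_derivative e j) (at z)" for j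
      unfolding e_def DERIV_deriv_iff_field_differentiable divide_inverse
      by (intro derivative_intros)
    note poly = this[THEN has_derivative_scaleC_const]
    have "(interp_poly u v N p q a has_derivative
        (\<lambda>h. h *\<^sub>C (- 1 / (v - u)) *\<^sub>C p + h *\<^sub>C (1 / (v - u)) *\<^sub>C q + (\<Sum>j<N. h *\<^sub>C e j *\<^sub>C a j))) (at z)"
      unfolding interp_poly_def[abs_def]
      by (intro has_derivative_add has_derivative_sum lin poly)
    then show ?thesis
      by (intro exI conjI allI)
        (assumption, simp add: scaleC_add_right scaleC.sum_right scaleC_scaleC scaleC_complex_def mult.assoc)
  qed
  with assms show ?thesis
    unfolding holomorphic_maps_def by blast
qed

text \<open>The common bound is independent of \<open>z\<close> and \<open>j\<close>, so one radius
  of coefficients serves for all points of a disc.\<close>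

lemma interp_poly_coeff_bounds:
  fixes u v z :: complex
  assumes "norm u < 1" "norm v < 1" "norm z < 1"
  shows "norm ((v - z) / (v - u)) \<le> 1 + 4 / norm (v - u)" (is ?A)
    and "norm ((z - u) / (v - u)) \<le> 1 + 4 / norm (v - u)" (is ?B)
    and "norm (z ^ j - (u ^ j * (v - z) + v ^ j * (z - u)) / (v - u)) \<le> 1 + 4 / norm (v - u)" (is ?C)
proof -
  have le2: "norm (v - z) \<le> 2" "norm (z - u) \<le> 2"
    using norm_triangle_ineq4[of v z] norm_triangle_ineq4[of z u] assms by auto
  have pow: "norm (w ^ j) \<le> 1" if "norm w < 1" for w :: complex
    using that by (simp add: norm_power power_le_one)
  have "norm (w ^ j * t) \<le> 2" if "norm w < 1" "norm t \<le> 2" for w t :: complex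
    using mult_mono[OF pow[OF that(1)] that(2)] by (simp add: norm_mult)
  then have "norm (u ^ j * (v - z) + v ^ j * (z - u)) \<le> 2 + 2"
    using assms le2 by (intro norm_triangle_mono) auto
  then have "norm ((u ^ j * (v - z) + v ^ j * (z - u)) / (v - u)) \<le> 4 / norm (v - u)"
    by (simp add: norm_divide divide_right_mono)
  then show ?C
    using pow[OF assms(3)] norm_triangle_ineq4[of "z ^ j"] by (meson add_mono order_trans)
  have "2 / norm (v - u) \<le> 1 + 4 / norm (v - u)"
    using divide_right_mono[of 2 4 "norm (v - u)"] by simp
  moreover have "norm ((v - z) / (v - u)) \<le> 2 / norm (v - u)" "norm ((z - u) / (v - u)) \<le> 2 / norm (v - u)"
    using le2 by (simp_all add: norm_divide divide_right_mono)
  ultimately show ?A ?B by linarith+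
qed

section \<open>Transferring chains of discs from the bidual\<close>

text \<open>Coefficients of the \<open>i\<close>-th disc with respect to all vectors of the chain,
  zero on vectors of other discs. It is applied with \<open>i \<ge> 1\<close>, where
  \<open>i - 1\<close> is the true predecessor.\<close>

fun interp_coeff :: "complex \<Rightarrow> complex \<Rightarrow> nat \<Rightarrow> complex \<Rightarrow> nat + nat \<times> nat \<Rightarrow> complex"
  where
    "interp_coeff u v i z (Inl k) =
      (if k = i - 1 then (v - z) / (v - u) else if k = i then (z - u) / (v - u) else 0)"
  | "interp_coeff u v i z (Inr (k, j)) =
      (if k = i then z ^ j - (u ^ j * (v - z) + v ^ j * (z - u)) / (v - u) else 0)"

text \<open>Brings the discs into the form required by local reflexivity: combinations of one vector
  family common to the whole chain.\<close>

lemma interp_poly_as_sum: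
  fixes d :: "nat + nat \<times> nat \<Rightarrow> 'a::complex_normed_vector"
  assumes i: "i \<in> {1..n}"
  shows "(\<Sum>s\<in>{..n} <+> Sigma {1..n} (\<lambda>k. {..<N k}). interp_coeff u v i z s *\<^sub>C d s) =
      interp_poly u v (N i) (d (Inl (i - 1))) (d (Inl i)) (\<lambda>j. d (Inr (i, j))) z"
proof -
  have "(\<Sum>k\<le>n. interp_coeff u v i z (Inl k) *\<^sub>C d (Inl k)) =
      (\<Sum>k\<le>n. if k = i - 1 then ((v - z) / (v - u)) *\<^sub>C d (Inl k) else 0) +
      (\<Sum>k\<le>n. if k = i then ((z - u) / (v - u)) *\<^sub>C d (Inl k) else 0)"
    unfolding sum.distrib[symmetric] using i
    by (intro sum.cong) (auto simp: scaleC.zero_left)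
  also have "\<dots> = ((v - z) / (v - u)) *\<^sub>C d (Inl (i - 1)) + ((z - u) / (v - u)) *\<^sub>C d (Inl i)"
    using i by (auto simp: le_diff_conv)
  finally have Inl: "(\<Sum>k\<le>n. interp_coeff u v i z (Inl k) *\<^sub>C d (Inl k)) = \<dots>" .
  have "(\<Sum>s\<in>Sigma {1..n} (\<lambda>k. {..<N k}). interp_coeff u v i z (Inr s) *\<^sub>C d (Inr s)) =
      (\<Sum>k\<in>{1..n}. \<Sum>j<N k. interp_coeff u v i z (Inr (k, j)) *\<^sub>C d (Inr (k, j)))"
    by (subst sum.Sigma) (simp_all add: case_prod_unfold del: interp_coeff.simps)
  also have "\<dots> = (\<Sum>k\<in>{1..n}. if k = i then
      (\<Sum>j<N i. (z ^ j - (u ^ j * (v - z) + v ^ j * (z - u)) / (v - u)) *\<^sub>C d (Inr (i, j))) else 0)"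
    by (intro sum.cong) (auto simp: scaleC.zero_left)
  also have "\<dots> = (\<Sum>j<N i. (z ^ j - (u ^ j * (v - z) + v ^ j * (z - u)) / (v - u)) *\<^sub>C d (Inr (i, j)))"
    using i by simp
  finally have Inr: "(\<Sum>s\<in>Sigma {1..n} (\<lambda>k. {..<N k}). interp_coeff u v i z (Inr s) *\<^sub>C d (Inr s)) = \<dots>" .
  show ?thesis
    unfolding interp_poly_def Inl[symmetric] Inr[symmetric]
    by (subst sum.Plus) (auto simp: o_def)
qed

text \<open>All discs of a chain are transferred at once, so that the intermediate points of the
  new chain fit together. The index \<open>Inl i\<close> stands for the \<open>i\<close>-th point of the chain, and
  \<open>Inr (i, j)\<close> for the \<open>j\<close>-th coefficient of the \<open>i\<close>-th disc.\<close>

lemma lempert_chain_bidual: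
  fixes x y :: "'a::complex_normed_vector" and w :: "nat \<Rightarrow> 'a cdual cdual"
  assumes n: "n \<ge> 1" and ends: "w 0 = canonical_embedding x" "w n = canonical_embedding y"
    and less: "\<And>i. i \<in> {1..n} \<Longrightarrow> lempert_fun (ball 0 1) (w (i - 1)) (w i) < ereal (e i)"
  obtains w' where "w' 0 = x" "w' n = y" "\<And>i. i \<le> n \<Longrightarrow> w' i \<in> ball 0 1"
    "\<And>i. i \<in> {1..n} \<Longrightarrow> lempert_fun (ball 0 1) (w' (i - 1)) (w' i) \<le> ereal (e i)"
proof -
  have "\<forall>i\<in>{1..n}. \<exists>u v N a M. norm u < 1 \<and> norm v < 1 \<and> u \<noteq> v \<and> poincare_dist u v < e i \<and>
      M < 1 \<and> (\<forall>z. norm z < 1 \<longrightarrow> norm (interp_poly u v N (w (i - 1)) (w i) a z) \<le> M)"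
    using dual_disc_interp_poly[OF less] by metis
  then have "\<exists>u v N a M. \<forall>i\<in>{1..n}. norm (u i) < 1 \<and> norm (v i) < 1 \<and> u i \<noteq> v i \<and>
      poincare_dist (u i) (v i) < e i \<and> M i < 1 \<and>
      (\<forall>z. norm z < 1 \<longrightarrow> norm (interp_poly (u i) (v i) (N i) (w (i - 1)) (w i) (a i) z) \<le> M i)"
    unfolding bchoice_iff .
  then obtain u v N a M where *: "\<forall>i\<in>{1..n}. norm (u i) < 1 \<and> norm (v i) < 1 \<and> u i \<noteq> v i \<and>
      poincare_dist (u i) (v i) < e i \<and> M i < 1 \<and>
      (\<forall>z. norm z < 1 \<longrightarrow> norm (interp_poly (u i) (v i) (N i) (w (i - 1)) (w i) (a i) z) \<le> M i)"
    by (elim exE) (erule that)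
  then have uv: "\<And>i. i \<in> {1..n} \<Longrightarrow> norm (u i) < 1"
      "\<And>i. i \<in> {1..n} \<Longrightarrow> norm (v i) < 1" "\<And>i. i \<in> {1..n} \<Longrightarrow> u i \<noteq> v i"
      "\<And>i. i \<in> {1..n} \<Longrightarrow> poincare_dist (u i) (v i) < e i"
    and M: "\<And>i. i \<in> {1..n} \<Longrightarrow> M i < 1"
      "\<And>i z. i \<in> {1..n} \<Longrightarrow> norm z < 1 \<Longrightarrow>
        norm (interp_poly (u i) (v i) (N i) (w (i - 1)) (w i) (a i) z) \<le> M i"
    by blast+
  \<comment> \<open>Half the smallest gap \<open>1 - M i\<close>, so that every disc remains in the
    open ball after the transfer.\<close>
  define \<epsilon> where "\<epsilon> = Min ((\<lambda>i. (1 - M i) / 2) ` {1..n})"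
  have \<epsilon>: "\<epsilon> > 0"
    unfolding \<epsilon>_def using n M(1) by (subst Min_gr_iff) auto
  have "\<epsilon> \<le> (1 - M i) / 2" if "i \<in> {1..n}" for i
    unfolding \<epsilon>_def using that by (intro Min_le) auto
  then have \<epsilon>_less: "M i + \<epsilon> < 1" if "i \<in> {1..n}" for i
    using M(1)[OF that] that by (fastforce simp: field_simps)
  define J where "J = {..n} <+> Sigma {1..n} (\<lambda>i. {..<N i})"
  define c where "c = case_sum w (\<lambda>(i, j). a i j)"
  define R where "R = (\<Sum>i\<in>{1..n}. 1 + 4 / norm (v i - u i))"
  have coeff_bound: "norm (interp_coeff (u i) (v i) i z s) \<le> R" if i: "i \<in> {1..n}" and z: "norm z < 1" for i z s
  proof -
    have le: "1 + 4 / norm (v i - u i) \<le> R"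
      unfolding R_def using i by (intro member_le_sum) (auto simp: add_nonneg_nonneg)
    then have "0 \<le> R"
      by (rule order.trans[rotated]) (simp add: add_nonneg_nonneg)
    with le show ?thesis
      using interp_poly_coeff_bounds[OF uv(1,2)[OF i] z, THEN order.trans[OF _ le]]
      by (cases "(u i, v i, i, z, s)" rule: interp_coeff.cases) simp_all
  qed
  \<comment> \<open>Only the two end points are held fixed; inner points and disc coefficients may
    move.\<close>
  obtain d where d: "\<And>s. s \<in> J \<inter> {Inl 0, Inl n} \<Longrightarrow> d s = (if s = Inl 0 then x else y)"
    and d_le: "\<And>l. (\<And>s. s \<in> J \<Longrightarrow> norm (l s) \<le> R) \<Longrightarrow>
        norm (\<Sum>s\<in>J. l s *\<^sub>C d s) \<le> norm (\<Sum>s\<in>J. l s *\<^sub>C c s) + \<epsilon>"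
  proof (rule approximate_local_reflexivity[OF _ _ \<epsilon>])
    show "finite J" unfolding J_def by (intro finite_Plus finite_SigmaI) auto
    show "c s = canonical_embedding (if s = Inl 0 then x else y)" if "s \<in> J \<inter> {Inl 0, Inl n}" for s
      using that ends by (auto simp: c_def)
  qed blast
  define w' where "w' i = d (Inl i)" for i
  define P where "P i = interp_poly (u i) (v i) (N i) (w' (i - 1)) (w' i) (\<lambda>j. d (Inr (i, j)))" for i
  have P: "norm (P i z) < 1" if i: "i \<in> {1..n}" and z: "norm z < 1" for i z
  proof -
    have "norm (P i z) = norm (\<Sum>s\<in>J. interp_coeff (u i) (v i) i z s *\<^sub>C d s)"
      by (simp add: P_def w'_def interp_poly_as_sum[OF i, where N = N, folded J_def])
    also have "\<dots> \<le> norm (\<Sum>s\<in>J. interp_coeff (u i) (v i) i z s *\<^sub>C c s) + \<epsilon>"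
      by (rule d_le) (rule coeff_bound[OF i z])
    also have "(\<Sum>s\<in>J. interp_coeff (u i) (v i) i z s *\<^sub>C c s) = interp_poly (u i) (v i) (N i) (w (i - 1)) (w i) (a i) z"
      by (simp add: interp_poly_as_sum[OF i, where N = N, folded J_def] c_def)
    finally show ?thesis
      using M(2)[OF i z] \<epsilon>_less[OF i] by linarith
  qed
  have nodes: "P i (u i) = w' (i - 1)" "P i (v i) = w' i" if "i \<in> {1..n}" for i
    unfolding P_def using interp_poly_nodes uv(3)[OF that] by auto
  show thesis
  proof
    show "w' 0 = x" "w' n = y"
      using n d[of "Inl 0"] d[of "Inl n"] by (auto simp: w'_def J_def)
    \<comment> \<open>Every point of the chain is a value of a disc: point 0 of the first disc at
      \<open>u 1\<close>, point \<open>i \<ge> 1\<close> of the \<open>i\<close>-th at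
      \<open>v i\<close>.\<close>
    show "w' i \<in> ball 0 1" if "i \<le> n" for i
    proof (cases "i = 0")
      case True
      then show ?thesis
        using P[of 1 "u 1"] nodes(1)[of 1] uv(1)[of 1] n by simp
    next
      case False
      then show ?thesis
        using P[of i "v i"] nodes(2)[of i] uv(2)[of i] that by simp
    qed
    fix i assume i: "i \<in> {1..n}"
    have "P i \<in> holomorphic_maps (ball 0 1) (ball 0 1)"
      using P[OF i] unfolding P_def by (intro interp_poly_holomorphic) auto
    then have "lempert_fun (ball 0 1) (w' (i - 1)) (w' i) \<le> ereal (poincare_dist (u i) (v i))"
      using nodes[OF i] uv(1,2)[OF i] by (intro lempert_fun_le[where f = "P i"])
    with uv(4)[OF i] show "lempert_fun (ball 0 1) (w' (i - 1)) (w' i) \<le> ereal (e i)"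
      by (meson ereal_less_eq(3) less_imp_le order_trans)
  qed
qed

section \<open>Contraction of the Kobayashi distance by the canonical embedding\<close>

lemma canonical_embedding_holomorphic:
  assumes "f \<in> holomorphic_maps S (ball 0 1)"
  shows "(\<lambda>z. canonical_embedding (f z)) \<in> holomorphic_maps S (ball 0 1)"
  unfolding holomorphic_maps_def
proof (intro CollectI conjI ballI)
  show "(\<lambda>z. canonical_embedding (f z)) ` S \<subseteq> ball 0 1"
    using assms le_less_trans[OF norm_canonical_embedding_le]
    unfolding holomorphic_maps_def by (auto simp: image_subset_iff)
  fix z assume "z \<in> S"
  then obtain L where "(f has_derivative L) (at z)" "\<And>c h. L (c *\<^sub>C h) = c *\<^sub>C L h"
    using assms unfolding holomorphic_maps_def by blast
  then show "\<exists>L. ((\<lambda>z. canonical_embedding (f z)) has_derivative L) (at z) \<and>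
      (\<forall>c h. L (c *\<^sub>C h) = c *\<^sub>C L h)"
    by (intro exI[of _ "\<lambda>h. canonical_embedding (L h)"] conjI
        bounded_linear.has_derivative[OF bounded_linear_canonical_embedding])
      (simp_all add: canonical_embedding_linear)
qed

lemma lempert_fun_canonical_embedding_le:
  "lempert_fun (ball 0 1) (canonical_embedding p) (canonical_embedding q) \<le> lempert_fun (ball 0 1) p q"
  unfolding lempert_fun_def
proof (rule Inf_superset_mono, clarify)
  fix u v :: complex and f :: "complex \<Rightarrow> 'a"
  assume "u \<in> ball 0 1" "v \<in> ball 0 1" "f \<in> holomorphic_maps (ball 0 1) (ball 0 1)"
  then show "\<exists>u' v'. ereal (poincare_dist u v) = ereal (poincare_dist u' v') \<and>
      u' \<in> ball 0 1 \<and> v' \<in> ball 0 1 \<and>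
      (\<exists>g\<in>holomorphic_maps (ball 0 1) (ball 0 1).
        g u' = canonical_embedding (f u) \<and> g v' = canonical_embedding (f v))"
    by (intro exI[of _ u] exI[of _ v] conjI bexI[OF _ canonical_embedding_holomorphic]) auto
qed

lemma kobayashi_dist_canonical_embedding_le:
  "kobayashi_dist (ball 0 1) (canonical_embedding p) (canonical_embedding q) \<le> kobayashi_dist (ball 0 1) p q"
  unfolding kobayashi_dist_def
proof (rule Inf_mono, clarify)
  fix n and w :: "nat \<Rightarrow> 'a"
  assume w: "n \<ge> 1" "\<forall>i\<le>n. w i \<in> ball 0 1"
  let ?w = "\<lambda>i. canonical_embedding (w i)"
  have *: "norm (?w i) < 1" if "i \<le> n" for i
    using w that norm_canonical_embedding_le[of "w i"] by (force intro: le_less_trans)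
  have "(\<Sum>i=1..n. lempert_fun (ball 0 1) (?w (i - 1)) (?w i)) \<le>
      (\<Sum>i=1..n. lempert_fun (ball 0 1) (w (i - 1)) (w i))"
    by (intro sum_mono lempert_fun_canonical_embedding_le)
  then show "\<exists>s\<in>{(\<Sum>i = 1..m. lempert_fun (ball 0 1) (w' (i - 1)) (w' i)) | (m::nat) w'.
      m \<ge> 1 \<and> w' 0 = ?w 0 \<and> w' m = ?w n \<and> (\<forall>i\<le>m. w' i \<in> ball 0 1)}.
      s \<le> (\<Sum>i = 1..n. lempert_fun (ball 0 1) (w (i - 1)) (w i))" (is "\<exists>s\<in>?A. _")
  proof (intro bexI)
    show "(\<Sum>i=1..n. lempert_fun (ball 0 1) (?w (i - 1)) (?w i)) \<in> ?A"
      unfolding mem_Collect_eq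
      by (rule exI[of _ n], rule exI[of _ ?w]) (use * w(1) in simp)
  qed
qed

theorem theorem2p4:
  fixes x y :: "'a::complex_banach"
  assumes "x \<in> ball 0 1" and "y \<in> ball 0 1"
  shows "kobayashi_dist (ball (0 :: 'a cdual cdual) 1) (canonical_embedding x) (canonical_embedding y)
       = kobayashi_dist (ball (0 :: 'a) 1) x y"
proof (rule antisym[OF kobayashi_dist_canonical_embedding_le])
  have *: "kobayashi_dist (ball 0 1) x y \<le> (\<Sum>i=1..n. lempert_fun (ball 0 1) (w (i - 1)) (w i))"
    if n: "n \<ge> 1" and w: "w 0 = canonical_embedding x" "w n = canonical_embedding y" for n :: nat and w
  proof (cases "(\<Sum>i=1..n. lempert_fun (ball 0 1) (w (i - 1)) (w i)) = \<infinity>")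
    case False
    define \<delta> where "\<delta> i = real_of_ereal (lempert_fun (ball 0 1) (w (i - 1)) (w i))" for i
    \<comment> \<open>A sum other than \<infinity> has no summand \<infinity>, and nonnegativity
      excludes the other infinite value.\<close>
    have \<delta>: "lempert_fun (ball 0 1) (w (i - 1)) (w i) = ereal (\<delta> i)" if "i \<in> {1..n}" for i
      using False that lempert_fun_nonneg[of "ball 0 1" "w (i - 1)" "w i"]
      unfolding sum_Pinfty \<delta>_def by (intro ereal_real'[symmetric]) auto
    show ?thesis
    proof (rule ereal_le_epsilon2)
      fix \<epsilon> :: real assume \<epsilon>: "0 < \<epsilon>"
      \<comment> \<open>The error \<open>\<epsilon>\<close> is shared equally among the
        \<open>n\<close> discs, which also makes the bounds strict as the chain lemma
        requires.\<close>
      obtain w' where w': "w' 0 = x" "w' n = y" "\<And>i. i \<le> n \<Longrightarrow> w' i \<in> ball 0 1"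
        "\<And>i. i \<in> {1..n} \<Longrightarrow> lempert_fun (ball 0 1) (w' (i - 1)) (w' i) \<le> ereal (\<delta> i + \<epsilon> / n)"
        by (rule lempert_chain_bidual[OF n w, of "\<lambda>i. \<delta> i + \<epsilon> / n"]) (use \<delta> n \<epsilon> in auto)
      have "kobayashi_dist (ball 0 1) x y \<le> (\<Sum>i=1..n. lempert_fun (ball 0 1) (w' (i - 1)) (w' i))"
        unfolding kobayashi_dist_def using n w' by (intro Inf_lower) blast
      also have "\<dots> \<le> (\<Sum>i=1..n. ereal (\<delta> i + \<epsilon> / n))"
        by (intro sum_mono w'(4))
      also have "\<dots> = (\<Sum>i=1..n. lempert_fun (ball 0 1) (w (i - 1)) (w i)) + ereal \<epsilon>"
      proof -
        have "(\<Sum>i=1..n. lempert_fun (ball 0 1) (w (i - 1)) (w i)) = (\<Sum>i=1..n. ereal (\<delta> i))"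
          by (rule sum.cong) (simp_all only: \<delta>)
        then show ?thesis
          using n by (simp add: sum.distrib)
      qed
      finally show "kobayashi_dist (ball 0 1) x y \<le>
          (\<Sum>i=1..n. lempert_fun (ball 0 1) (w (i - 1)) (w i)) + ereal \<epsilon>" .
    qed
  qed simp_all
  show "kobayashi_dist (ball (0 :: 'a) 1) x y \<le>
      kobayashi_dist (ball (0 :: 'a cdual cdual) 1) (canonical_embedding x) (canonical_embedding y)"
    unfolding kobayashi_dist_def[of "ball 0 1" "canonical_embedding x"]
    by (rule Inf_greatest) (use * in blast)
qed

end
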